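(* (i) Let $F=\{f_1,\dots,f_k\}$ be a system of tropical polynomials in $n$ variables over the semiring $\mathbb{R}$, let $d_i=\deg(f_i)$, and let $N=(n+2)(d_1+\dots+d_k)$. Then $F$ has a root in $\mathbb{R}^n$ if and only if the Macaulay tropical linear system $M_N\odot \vec y$ has a solution over $\mathbb{R}$. (ii) There is a fixed polynomial $p$ with the following property. Let $F=\{f_1,\dots,f_k\}$ be any system of tropical polynomials in $n$ variables over the semiring $\mathbb{R}_\infty$, let $d=\max_i\deg(f_i)$, and let $N=p(n,k,d)\,(4d)^{\min(n,k)}$. Then $F$ has a root in $\mathbb{R}_\infty^n$ if and only if the Macaulay tropical non-homogeneous linear system $M_N\odot(0,\vec y)$ has a solution over $\mathbb{R}_\infty$.
   Context: $\mathbb{R}_\infty=\mathbb{R}\cup\{+\infty\}$. Tropical operations on $\mathbb{K}\in\{\mathbb{R},\mathbb{R}_\infty\}$: $x\oplus y=\min\{x,y\}$, $x\odot y=x+y$. A tropical monomial is $m(\vec x)=c\odot \vec x^{I}$ with $c\in\mathbb{K}$, $I=(i_1,\dots,i_n)\in\mathbb{Z}_{\ge0}^n$ and $\vec x^{I}=i_1x_1+\dots+i_nx_n$ in classical notation (with $0\cdot\infty=0$); its degree is $|I|=i_1+\dots+i_n$. A tropical polynomial is a finite tropical sum $f=\bigoplus_i m_i=\min_i m_i$ of monomials with pairwise distinct exponent vectors; its degree $\deg(f)$ is the maximal degree of its monomials. A point $\vec a\in\mathbb{K}^n$ is a root of $f$ if $\min_i m_i(\vec a)$ is attained on at least two different monomials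 or is equal to $\infty$. A root of a system is a common root of all its polynomials. Macaulay matrix: for $F=\{f_1,\dots,f_k\}$, the infinite matrix $M$ has columns indexed by $I\in\mathbb{Z}_{\ge0}^n$ and rows indexed by pairs $(j,J)$ with $1\le j\le k$, $J\in\mathbb{Z}_{\ge0}^n$; the entry in row $(j,J)$ and column $I$ is the coefficient of $\vec x^I$ in $\vec x^J\odot f_j$ (equal to $\infty$ if there is no such monomial). $M_N$ is the finite submatrix consisting of the columns $I$ with $|I|\le N$ and of those rows of $M$ all of whose finite entries lie in these columns. Tropical linear systems: a vector $\vec y$ is a solution of $A\odot\vec y$ (with $A=(a_{ij})$ having entries in $\mathbb{R}_\infty$) if for each row $i$ the minimum $\min_j(a_{ij}+y_j)$ is attained for at least two different $j$ or equals $\infty$. Over $\mathbb{R}$ all coordinates of $\vec y$ are required to be finite. Over $\mathbb{R}_\infty$, a solution of the non-homogeneous system $M_N\odot(0,\vec y)$ is a solution with coordinates in $\mathbb{R}_\infty$ whose coordinate corresponding to the column $I=\vec 0$ (the constant monomial) equals $0$. *)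

theory Defs
  imports "HOL-Library.Extended_Real" "HOL-Computational_Algebra.Polynomial"
begin

text \<open>Both tropical semirings live in \<^typ>\<open>ereal\<close>, where already $0 \cdot \infty = 0$; only the
  value $-\infty$ has to be excluded.\<close>

definition trop_R :: "ereal set" where
  "trop_R = range ereal"

definition trop_Rinf :: "ereal set" where
  "trop_Rinf = UNIV - {-\<infinity>}"

text \<open>An exponent vector in $n$ variables is a function on \<^typ>\<open>nat\<close> vanishing from index $n$ on, so
  that distinct functions are distinct vectors. Of a point only the coordinates below $n$ are used.\<close>

definition exponents :: "nat \<Rightarrow> (nat \<Rightarrow> nat) set" where
  "exponents n = {I. \<forall>i\<ge>n. I i = 0}"

definition exp_deg :: "nat \<Rightarrow> (nat \<Rightarrow> nat) \<Rightarrow> nat" where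
  "exp_deg n I = (\<Sum>i<n. I i)"

definition exp_eval :: "nat \<Rightarrow> (nat \<Rightarrow> nat) \<Rightarrow> (nat \<Rightarrow> ereal) \<Rightarrow> ereal" where
  "exp_eval n I x = (\<Sum>i<n. ereal (real (I i)) * x i)"

text \<open>A tropical polynomial is its finite nonempty set of monomials, as a partial map from exponent
  vectors to coefficients. Over \<^const>\<open>trop_Rinf\<close> a monomial that is present may have the
  coefficient $\infty$; in particular the constant polynomial $\infty$ is allowed.\<close>

type_synonym trop_poly = "(nat \<Rightarrow> nat) \<Rightarrow> ereal option"

definition is_trop_poly :: "ereal set \<Rightarrow> nat \<Rightarrow> trop_poly \<Rightarrow> bool" where
  "is_trop_poly K n f \<longleftrightarrow>
     finite (dom f) \<and> dom f \<noteq> {} \<and> dom f \<subseteq> exponents n \<and> ran f \<subseteq> K"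

definition trop_deg :: "nat \<Rightarrow> trop_poly \<Rightarrow> nat" where
  "trop_deg n f = Max (exp_deg n ` dom f)"

definition trop_coeff :: "trop_poly \<Rightarrow> (nat \<Rightarrow> nat) \<Rightarrow> ereal" where
  "trop_coeff f I = (case f I of None \<Rightarrow> \<infinity> | Some c \<Rightarrow> c)"

text \<open>The index sets used below are finite, so the infimum is a minimum.\<close>

definition trop_vanishes :: "'i set \<Rightarrow> ('i \<Rightarrow> ereal) \<Rightarrow> bool" where
  "trop_vanishes S v \<longleftrightarrow>
     (INF i\<in>S. v i) = \<infinity> \<or>
     (\<exists>i\<in>S. \<exists>j\<in>S. i \<noteq> j \<and> v i = (INF l\<in>S. v l) \<and> v j = (INF l\<in>S. v l))"

definition is_root :: "nat \<Rightarrow> trop_poly \<Rightarrow> (nat \<Rightarrow> ereal) \<Rightarrow> bool" where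
  "is_root n f x \<longleftrightarrow> trop_vanishes (dom f) (\<lambda>I. trop_coeff f I + exp_eval n I x)"

definition has_root :: "ereal set \<Rightarrow> nat \<Rightarrow> trop_poly list \<Rightarrow> bool" where
  "has_root K n F \<longleftrightarrow> (\<exists>x. (\<forall>i<n. x i \<in> K) \<and> (\<forall>f\<in>set F. is_root n f x))"

text \<open>The product of the monomial with exponent vector \<open>J\<close> and coefficient $0$ (the tropical unit)
  with \<open>f\<close>.\<close>

definition monom_times :: "(nat \<Rightarrow> nat) \<Rightarrow> trop_poly \<Rightarrow> trop_poly" where
  "monom_times J f = (\<lambda>I. if \<forall>i. J i \<le> I i then f (\<lambda>i. I i - J i) else None)"

definition macaulay :: "trop_poly list \<Rightarrow> nat \<times> (nat \<Rightarrow> nat) \<Rightarrow> (nat \<Rightarrow> nat) \<Rightarrow> ereal" where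
  "macaulay F = (\<lambda>(j, J) I. trop_coeff (monom_times J (F ! j)) I)"

definition macaulay_cols :: "nat \<Rightarrow> nat \<Rightarrow> (nat \<Rightarrow> nat) set" where
  "macaulay_cols n N = {I \<in> exponents n. exp_deg n I \<le> N}"

definition macaulay_rows :: "nat \<Rightarrow> trop_poly list \<Rightarrow> nat \<Rightarrow> (nat \<times> (nat \<Rightarrow> nat)) set" where
  "macaulay_rows n F N =
     {r \<in> {..<length F} \<times> exponents n.
        \<forall>I\<in>exponents n. macaulay F r I \<noteq> \<infinity> \<longrightarrow> I \<in> macaulay_cols n N}"

definition is_lin_solution ::
  "ereal set \<Rightarrow> 'r set \<Rightarrow> 'c set \<Rightarrow> ('r \<Rightarrow> 'c \<Rightarrow> ereal) \<Rightarrow> ('c \<Rightarrow> ereal) \<Rightarrow> bool" where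
  "is_lin_solution K R C A y \<longleftrightarrow>
     (\<forall>c\<in>C. y c \<in> K) \<and> (\<forall>r\<in>R. trop_vanishes C (\<lambda>c. A r c + y c))"

definition macaulay_solution ::
  "ereal set \<Rightarrow> nat \<Rightarrow> trop_poly list \<Rightarrow> nat \<Rightarrow> ((nat \<Rightarrow> nat) \<Rightarrow> ereal) \<Rightarrow> bool" where
  "macaulay_solution K n F N y \<longleftrightarrow>
     is_lin_solution K (macaulay_rows n F N) (macaulay_cols n N) (macaulay F) y"

text \<open>Polynomials in three variables are iterated univariate polynomials. The coefficients are
  natural numbers because the value is used as a degree bound.\<close>

definition poly3 :: "nat poly poly poly \<Rightarrow> nat \<Rightarrow> nat \<Rightarrow> nat \<Rightarrow> nat" where
  "poly3 p a b c = poly (poly (poly p [:[:c:]:]) [:b:]) a"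

end

theory Submission
  imports Defs "HOL-Analysis.Function_Topology"
begin

text \<open>
  A common root \<open>x\<close> gives the solution \<open>y I = \<langle>I, x\<rangle>\<close> of every Macaulay system, because multiplying a
  polynomial by \<open>x\<^sup>J\<close> shifts all its values at \<open>x\<close> by the same amount. The content of both statements is the
  converse, and its engine is the same for both.

  \<^bold>\<open>Finite solutions.\<close> Suppose that no real point is a common root. Let \<open>h\<close> be the sum of the concave
  functions \<open>f\<^sub>j\<close> and of a small strictly concave penalty, and for a lattice point \<open>v\<close> let \<open>a\<^sub>v\<close> be the
  maximiser of \<open>h a - \<langle>v, a\<rangle>\<close> and \<open>w v\<close> the maximum (a Legendre transform). At \<open>a\<^sub>v\<close> some \<open>f\<^sub>j\<close>
  attains its minimum at a single monomial \<open>I\<^sub>0\<close>. Near \<open>a\<^sub>v\<close> the function \<open>f\<^sub>j\<close> is then linear, and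
  replacing it by this linear function globally keeps \<open>a\<^sub>v\<close> the strict global maximiser, by concavity.
  Comparing the two functions gives \<open>w (v - I\<^sub>0 + I) - w v < c\<^sub>I - c\<^sub>I\<^sub>0\<close> for every other monomial \<open>I\<close> of
  \<open>f\<^sub>j\<close>, see \<open>newton_point_step\<close>. So if \<open>v\<close> minimises \<open>w + y\<close> over the finitely many lattice points that
  have a maximiser, the row of \<open>f\<^sub>j\<close> shifted by \<open>J = v - I\<^sub>0\<close> has its minimum only in column \<open>v\<close>, and \<open>y\<close> is
  no solution. Since the penalty has slopes below \<open>1\<close>, integrality gives \<open>J \<ge> 0\<close> and the
  degree bound \<open>\<Sum>\<^sub>j d\<^sub>j\<close>.

  \<^bold>\<open>Infinite entries.\<close> If \<open>y\<close> may be infinite, the argument applies to a set \<open>L\<close> of variables,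
  all others being \<open>\<infinity>\<close>, and to the polynomials that have a monomial in \<open>L\<close> (the active ones). It does
  not give a contradiction but a point where \<open>y\<close> is finite and where some variable outside \<open>L\<close> has been
  acquired at the expense of one monomial of an active polynomial (\<open>leave_face\<close>). To start, one needs an exponent
  vector that can pay for one monomial of every active polynomial; performing \<open>k\<close> such steps at
  a time makes this initial expense comparable to that of the steps (\<open>trade_for_new_variables\<close>).

  It remains to see that these trades cannot go on for long. Given an exponent vector \<open>t\<close> with \<open>y t\<close>
  finite, consider a decreasing chain of sets \<open>L\<^sub>1 \<supseteq> L\<^sub>2 \<supseteq> \<dots>\<close>, where \<open>L\<^sub>q\<close> collects the
  variables whose exponent exceeds a threshold proportional to \<open>q\<close>. Among the first \<open>min n k + 2\<close> sets two
  consecutive ones have the same active polynomials, because otherwise both the number of variables and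
  that of active polynomials would drop too often. For such a pair the trade is paid from variables
  above level \<open>q + 1\<close> and gains units of variables below level \<open>q\<close>. A concave potential whose slope falls by the
  factor \<open>4d\<close> from level to level increases with every trade (\<open>potential_increases\<close>); being bounded
  by a polynomial times \<open>(4d)\<close> to the power \<open>min n k\<close>, it bounds the number of trades, hence all degrees that
  occur. Once \<open>N\<close> exceeds these degrees, a solution forces a root.
\<close>

section \<open>Maxima of concave functions on coordinate space\<close>

text \<open>
  Real points live on an arbitrary index type; normalising the coordinates outside \<open>L\<close> to \<open>0\<close> makes a maximiser
  unique as a function and keeps boxes compact in the product topology.
\<close>

definition euclid :: "'i set \<Rightarrow> ('i \<Rightarrow> real) set" where
  "euclid L = {a. \<forall>i. i \<notin> L \<longrightarrow> a i = 0}"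

definition dot :: "'i set \<Rightarrow> ('i \<Rightarrow> nat) \<Rightarrow> ('i \<Rightarrow> real) \<Rightarrow> real" where
  "dot L v a = (\<Sum>i\<in>L. real (v i) * a i)"

definition l1 :: "'i set \<Rightarrow> ('i \<Rightarrow> real) \<Rightarrow> real" where
  "l1 L a = (\<Sum>i\<in>L. \<bar>a i\<bar>)"

definition seg :: "real \<Rightarrow> ('i \<Rightarrow> real) \<Rightarrow> ('i \<Rightarrow> real) \<Rightarrow> 'i \<Rightarrow> real" where
  "seg t a b = (\<lambda>i. (1 - t) * a i + t * b i)"

lemma seg_in_euclid: "a \<in> euclid L \<Longrightarrow> b \<in> euclid L \<Longrightarrow> seg t a b \<in> euclid L"
  by (simp add: euclid_def seg_def)

lemma dot_seg: "dot L v (seg t a b) = (1 - t) * dot L v a + t * dot L v b"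
  by (simp add: dot_def seg_def algebra_simps sum.distrib sum_distrib_left sum_subtractf)

lemma continuous_on_dot: "continuous_on X (dot L v)"
  unfolding dot_def by (intro continuous_intros continuous_on_product_coordinates[THEN continuous_on_subset]) auto

lemma continuous_on_l1: "continuous_on X (\<lambda>a. l1 L (\<lambda>i. a i - b i))"
  unfolding l1_def by (intro continuous_intros continuous_on_product_coordinates[THEN continuous_on_subset]) auto

lemma compact_box:
  fixes r :: "'i \<Rightarrow> real"
  shows "compact {a. \<forall>i. a i \<in> {s i..r i}}"
proof -
  have "compactin (product_topology (\<lambda>i. euclidean) UNIV) (PiE UNIV (\<lambda>i. {s i..r i}))"
    by (subst compactin_PiE) simp
  then show ?thesis
    by (simp add: euclidean_product_topology PiE_def Pi_def)
qed

lemma compact_euclid_box: "compact {a \<in> euclid L. \<forall>i\<in>L. \<bar>a i - b i\<bar> \<le> r}"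
proof -
  have "{a \<in> euclid L. \<forall>i\<in>L. \<bar>a i - b i\<bar> \<le> r}
     = {a. \<forall>i. a i \<in> {(if i \<in> L then b i - r else 0)..(if i \<in> L then b i + r else 0)}}"
    by (auto simp: euclid_def abs_le_iff) (smt (verit) order_antisym)+
  then show ?thesis using compact_box by metis
qed

lemma attains_max_if_coercive:
  fixes \<psi> :: "('i \<Rightarrow> real) \<Rightarrow> real"
  assumes L: "finite L" and cont: "continuous_on (euclid L) \<psi>" and \<delta>: "\<delta> > 0"
    and bound: "\<And>a. a \<in> euclid L \<Longrightarrow> \<psi> a \<le> C - \<delta> * l1 L a"
  shows "\<exists>a\<in>euclid L. \<forall>b\<in>euclid L. \<psi> b \<le> \<psi> a"
proof -
  have z: "(\<lambda>_. 0) \<in> euclid L" by (simp add: euclid_def)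
  \<comment> \<open>Outside the box of this radius the bound lies below the value at the origin.\<close>
  define r where "r = (C - \<psi> (\<lambda>_. 0)) / \<delta>"
  have r: "r \<ge> 0" using bound[OF z] \<delta> by (simp add: r_def l1_def)
  define B where "B = {a \<in> euclid L. \<forall>i\<in>L. \<bar>a i - 0\<bar> \<le> r}"
  have "compact B" unfolding B_def using compact_euclid_box[of L "\<lambda>_. 0" r] by simp
  moreover have zB: "(\<lambda>_. 0) \<in> B" using z r by (simp add: B_def)
  moreover have "continuous_on B \<psi>" using cont by (rule continuous_on_subset) (auto simp: B_def)
  ultimately obtain a where a: "a \<in> B" "\<And>b. b \<in> B \<Longrightarrow> \<psi> b \<le> \<psi> a"
    using continuous_attains_sup[of B \<psi>] by blast
  have "\<psi> b \<le> \<psi> a" if b: "b \<in> euclid L" for b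
  proof (cases "b \<in> B")
    case False
    then obtain i where i: "i \<in> L" "\<bar>b i\<bar> > r" using b by (auto simp: B_def)
    have "\<bar>b i\<bar> \<le> l1 L b" unfolding l1_def using L i by (intro member_le_sum) auto
    then have "r < l1 L b" using i by simp
    then have "C - \<psi> (\<lambda>_. 0) < \<delta> * l1 L b" using \<delta> by (simp add: r_def field_simps)
    then have "\<psi> b \<le> \<psi> (\<lambda>_. 0)" using bound[OF b] by simp
    then show ?thesis using a(2)[OF zB] by simp
  qed (use a in blast)
  then show ?thesis using a by (auto simp: B_def)
qed

text \<open>
  On the unit sphere around the maximiser \<open>p\<close> compactness gives a gap \<open>\<delta>\<close> below the maximum, and concavity
  along rays from \<open>p\<close> turns the gap into linear decay.
\<close>

lemma coercive_if_strict_max: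
  fixes \<phi> :: "('i \<Rightarrow> real) \<Rightarrow> real"
  assumes L: "finite L" and cont: "continuous_on (euclid L) \<phi>"
    and conc: "\<And>a b t. a \<in> euclid L \<Longrightarrow> b \<in> euclid L \<Longrightarrow> 0 \<le> t \<Longrightarrow> t \<le> 1 \<Longrightarrow>
       (1 - t) * \<phi> a + t * \<phi> b \<le> \<phi> (seg t a b)"
    and p: "p \<in> euclid L" and max: "\<And>b. b \<in> euclid L \<Longrightarrow> b \<noteq> p \<Longrightarrow> \<phi> b < \<phi> p"
  shows "\<exists>\<delta>>0. \<exists>C. \<forall>a\<in>euclid L. \<phi> a \<le> C - \<delta> * l1 L a"
proof -
  let ?r = "\<lambda>a. l1 L (\<lambda>i. a i - p i)"
  define K where "K = {a \<in> euclid L. \<forall>i\<in>L. \<bar>a i - p i\<bar> \<le> 1} \<inter> {a. ?r a = 1}"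
  have "closed {a. ?r a = 1}"
    using continuous_on_l1[of UNIV L p] by (intro closed_Collect_eq continuous_intros) auto
  then have K: "compact K" unfolding K_def using compact_euclid_box by (intro compact_Int_closed)
  have "\<exists>\<delta>>0. \<forall>a\<in>K. \<phi> a \<le> \<phi> p - \<delta>"
  proof (cases "K = {}")
    case False
    have "continuous_on K \<phi>" using cont by (rule continuous_on_subset) (auto simp: K_def)
    then obtain q where q: "q \<in> K" "\<And>b. b \<in> K \<Longrightarrow> \<phi> b \<le> \<phi> q"
      using continuous_attains_sup[OF K False] by blast
    have "q \<noteq> p" using q(1) by (auto simp: K_def l1_def)
    then have "\<phi> q < \<phi> p" using max q(1) by (auto simp: K_def)
    then show ?thesis using q by (intro exI[of _ "\<phi> p - \<phi> q"]) auto
  qed (auto intro: exI[of _ 1])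
  then obtain \<delta> where \<delta>: "\<delta> > 0" "\<And>a. a \<in> K \<Longrightarrow> \<phi> a \<le> \<phi> p - \<delta>" by blast
  have key: "\<phi> a \<le> \<phi> p + \<delta> - \<delta> * ?r a" if a: "a \<in> euclid L" for a
  proof (cases "?r a < 1")
    case True
    then have "\<delta> * ?r a \<le> \<delta>" using \<delta>(1) by simp
    moreover have "\<phi> a \<le> \<phi> p" using max[OF a] by (cases "a = p") auto
    ultimately show ?thesis by simp
  next
    case False
    define t where "t = 1 / ?r a"
    have t: "0 < t" "t \<le> 1" using False by (auto simp: t_def)
    have tr: "t * ?r a = 1" using False by (auto simp: t_def)
    define b where "b = seg t p a"
    have bp: "b i - p i = t * (a i - p i)" for i by (simp add: b_def seg_def algebra_simps)
    have rb: "?r b = 1" unfolding l1_def bp abs_mult sum_distrib_left[symmetric] using t(1) tr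
      by (simp add: l1_def)
    have "\<bar>b i - p i\<bar> \<le> ?r b" if "i \<in> L" for i
      unfolding l1_def using L that by (intro member_le_sum[of i L "\<lambda>i. \<bar>b i - p i\<bar>"]) auto
    then have "b \<in> K" using rb a p by (auto simp: K_def b_def intro: seg_in_euclid)
    then have "(1 - t) * \<phi> p + t * \<phi> a \<le> \<phi> p - \<delta>"
      using \<delta>(2) conc[OF p a, of t] t unfolding b_def by fastforce
    then have "t * \<phi> a \<le> t * \<phi> p - \<delta> * (t * ?r a)" using tr by (simp add: algebra_simps)
    then have "t * \<phi> a \<le> t * (\<phi> p - \<delta> * ?r a)" by (simp add: algebra_simps)
    then have "\<phi> a \<le> \<phi> p - \<delta> * ?r a" using t(1) by simp
    then show ?thesis using \<delta> by simp
  qed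
  have "\<phi> a \<le> (\<phi> p + \<delta> + \<delta> * l1 L p) - \<delta> * l1 L a" if a: "a \<in> euclid L" for a
  proof -
    have "l1 L a \<le> ?r a + l1 L p" unfolding l1_def sum.distrib[symmetric] by (intro sum_mono) auto
    then have "\<delta> * l1 L a \<le> \<delta> * ?r a + \<delta> * l1 L p"
      using \<delta>(1) by (metis distrib_left mult_le_cancel_left_pos)
    then show ?thesis using key[OF a] by simp
  qed
  then show ?thesis using \<delta>(1) by blast
qed

text \<open>
  After squaring, the claim is \<open>1 + x * y < sqrt (1 + x\<^sup>2) * sqrt (1 + y\<^sup>2)\<close>, whose sides differ in their squares by
  \<open>(x - y)\<^sup>2\<close>.
\<close>

lemma sqrt_strictly_convex:
  fixes x y t :: real
  assumes "x \<noteq> y" "0 < t" "t < 1"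
  shows "sqrt (1 + ((1 - t) * x + t * y)\<^sup>2) < (1 - t) * sqrt (1 + x\<^sup>2) + t * sqrt (1 + y\<^sup>2)"
proof -
  let ?X = "sqrt (1 + x\<^sup>2)" and ?Y = "sqrt (1 + y\<^sup>2)"
  have pos: "1 + z\<^sup>2 \<ge> 0" for z :: real by (simp add: add_nonneg_nonneg)
  have sq: "?X\<^sup>2 = 1 + x\<^sup>2" "?Y\<^sup>2 = 1 + y\<^sup>2" using pos by auto
  have "(1 + x * y)\<^sup>2 < (1 + x * y)\<^sup>2 + (x - y)\<^sup>2" using assms(1) by simp
  also have "\<dots> = (?X * ?Y)\<^sup>2" by (simp add: power_mult_distrib sq) (simp add: power2_eq_square algebra_simps)
  finally have "1 + x * y < ?X * ?Y"
    by (smt (verit) mult_nonneg_nonneg pos power2_less_imp_less real_sqrt_ge_zero)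
  then have "2 * (t * (1 - t)) * (1 + x * y) < 2 * (t * (1 - t)) * (?X * ?Y)" using assms by simp
  then have "1 + ((1 - t) * x + t * y)\<^sup>2 < (1 - t)\<^sup>2 * ?X\<^sup>2 + t\<^sup>2 * ?Y\<^sup>2 + 2 * (t * (1 - t)) * (?X * ?Y)"
    unfolding sq by (simp add: power2_eq_square algebra_simps)
  also have "\<dots> = ((1 - t) * ?X + t * ?Y)\<^sup>2" by (simp add: power2_eq_square algebra_simps)
  finally show ?thesis using assms pos by (intro real_less_lsqrt) (auto intro!: add_nonneg_nonneg)
qed

text \<open>
  Strictly convex, at least linear growth, and total slope below \<open>1\<close> even when all coordinates move together:
  this is what the division by \<open>card L + 1\<close> is for, since integrality absorbs errors below \<open>1\<close>.
\<close>

definition penalty :: "'i set \<Rightarrow> ('i \<Rightarrow> real) \<Rightarrow> real" where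
  "penalty L a = (\<Sum>i\<in>L. sqrt (1 + (a i)\<^sup>2)) / (card L + 1)"

lemma l1_le_penalty: "l1 L a / (card L + 1) \<le> penalty L a"
  unfolding l1_def penalty_def by (intro divide_right_mono sum_mono) (auto intro: real_le_rsqrt)

lemma continuous_on_penalty: "continuous_on X (penalty L)"
  unfolding penalty_def
  by (intro continuous_intros continuous_on_product_coordinates[THEN continuous_on_subset]) auto

lemma penalty_strictly_convex:
  assumes L: "finite L" and "a \<in> euclid L" "b \<in> euclid L" "a \<noteq> b" "0 < t" "t < 1"
  shows "penalty L (seg t a b) < (1 - t) * penalty L a + t * penalty L b"
proof -
  obtain i where i: "i \<in> L" "a i \<noteq> b i" using assms by (auto simp: euclid_def fun_eq_iff) metis
  let ?s = "\<lambda>x::real. sqrt (1 + x\<^sup>2)"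
  have "?s ((1 - t) * x + t * y) \<le> (1 - t) * ?s x + t * ?s y" for x y
    using sqrt_strictly_convex[OF _ assms(5,6), of x y] by (cases "x = y") (auto simp: algebra_simps)
  then have "(\<Sum>i\<in>L. ?s ((1 - t) * a i + t * b i)) < (\<Sum>i\<in>L. (1 - t) * ?s (a i) + t * ?s (b i))"
    using L i sqrt_strictly_convex[OF i(2) assms(5,6)] by (intro sum_strict_mono_ex1) auto
  then have "(\<Sum>i\<in>L. ?s ((1 - t) * a i + t * b i)) / (card L + 1) 
      < (\<Sum>i\<in>L. (1 - t) * ?s (a i) + t * ?s (b i)) / (card L + 1)"
    by (intro divide_strict_right_mono) auto
  then show ?thesis unfolding penalty_def seg_def
    by (simp add: sum.distrib sum_distrib_left add_divide_distrib)
qed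

lemma penalty_lipschitz: "penalty L b \<le> penalty L a + l1 L (\<lambda>i. b i - a i) / (card L + 1)"
proof -
  have "sqrt (1 + y\<^sup>2) \<le> sqrt (1 + x\<^sup>2) + \<bar>y - x\<bar>" for x y :: real
    using real_sqrt_sum_squares_triangle_ineq[of 1 0 x "y - x"] by simp
  then have "(\<Sum>i\<in>L. sqrt (1 + (b i)\<^sup>2)) \<le> (\<Sum>i\<in>L. sqrt (1 + (a i)\<^sup>2)) + l1 L (\<lambda>i. b i - a i)"
    unfolding l1_def sum.distrib[symmetric] by (intro sum_mono)
  then show ?thesis unfolding penalty_def add_divide_distrib[symmetric] by (intro divide_right_mono) auto
qed

lemma continuous_on_Min_image:
  fixes f :: "'x \<Rightarrow> 'a::topological_space \<Rightarrow> real"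
  assumes "finite T" "T \<noteq> {}" "\<And>x. x \<in> T \<Longrightarrow> continuous_on X (f x)"
  shows "continuous_on X (\<lambda>a. Min ((\<lambda>x. f x a) ` T))"
  using assms
proof (induction T rule: finite_ne_induct)
  case (insert x T)
  then show ?case by (simp add: continuous_on_min)
qed simp

section \<open>Weights on the lattice points of a system without common root\<close>

text \<open>
  The polynomials with index in \<open>W\<close> have exponent set \<open>S j\<close>, real coefficients \<open>c j\<close>, and use only the
  variables in \<open>L\<close>. The number \<open>d j\<close> need only bound the degree: a polynomial restricted to \<open>L\<close> keeps the
  degree bound of the full polynomial.
\<close>

locale rootless_system =
  fixes L :: "nat set" and W :: "'j set" and S :: "'j \<Rightarrow> (nat \<Rightarrow> nat) set"
    and c :: "'j \<Rightarrow> (nat \<Rightarrow> nat) \<Rightarrow> real" and d :: "'j \<Rightarrow> nat"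
  assumes finite_L: "finite L" and finite_W: "finite W"
    and finite_S: "j \<in> W \<Longrightarrow> finite (S j)"
    and S_nonempty: "j \<in> W \<Longrightarrow> S j \<noteq> {}"
    and S_support: "j \<in> W \<Longrightarrow> I \<in> S j \<Longrightarrow> i \<notin> L \<Longrightarrow> I i = 0"
    and S_degree: "j \<in> W \<Longrightarrow> I \<in> S j \<Longrightarrow> (\<Sum>i\<in>L. I i) \<le> d j"
    and no_root: "\<And>a. \<exists>j\<in>W. \<exists>I\<in>S j. \<forall>I'\<in>S j. I' \<noteq> I \<longrightarrow> c j I + dot L I a < c j I' + dot L I' a"
begin

definition trop_val :: "'j \<Rightarrow> (nat \<Rightarrow> real) \<Rightarrow> real" where
  "trop_val j a = Min ((\<lambda>I. c j I + dot L I a) ` S j)"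

lemma trop_val_le: "j \<in> W \<Longrightarrow> I \<in> S j \<Longrightarrow> trop_val j a \<le> c j I + dot L I a"
  unfolding trop_val_def by (intro Min_le) (auto simp: finite_S)

lemma trop_val_attained: "j \<in> W \<Longrightarrow> \<exists>I\<in>S j. trop_val j a = c j I + dot L I a"
proof -
  assume "j \<in> W"
  then have "trop_val j a \<in> (\<lambda>I. c j I + dot L I a) ` S j"
    unfolding trop_val_def using finite_S S_nonempty by (intro Min_in) auto
  then show ?thesis by auto
qed

lemma trop_val_concave:
  assumes j: "j \<in> W" and t: "0 \<le> t" "t \<le> 1"
  shows "(1 - t) * trop_val j a + t * trop_val j b \<le> trop_val j (seg t a b)"
proof -
  obtain I where I: "I \<in> S j" "trop_val j (seg t a b) = c j I + dot L I (seg t a b)"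
    using trop_val_attained[OF j] by blast
  have "(1 - t) * trop_val j a \<le> (1 - t) * (c j I + dot L I a)"
       "t * trop_val j b \<le> t * (c j I + dot L I b)"
    using t trop_val_le[OF j I(1)] by (auto intro!: mult_left_mono)
  then show ?thesis unfolding I(2) dot_seg by (simp add: algebra_simps)
qed

lemma continuous_on_trop_val: "j \<in> W \<Longrightarrow> continuous_on X (trop_val j)"
  unfolding trop_val_def[abs_def] using finite_S S_nonempty
  by (intro continuous_on_Min_image continuous_intros continuous_on_dot) auto

definition height :: "(nat \<Rightarrow> nat) \<Rightarrow> (nat \<Rightarrow> real) \<Rightarrow> real" where
  "height v a = (\<Sum>j\<in>W. trop_val j a) - penalty L a - dot L v a"

text \<open>
  Without the penalty, the height of \<open>v\<close> is bounded above exactly when \<open>v\<close> lies in the Minkowski sum of the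
  Newton polytopes; with it, lattice points slightly off the polytope may qualify too. The condition is that the
  maximum is attained, because this property passes from a point to its neighbours in
  \<open>newton_point_step\<close>.
\<close>

definition "newton_points = {v. (\<forall>i. i \<notin> L \<longrightarrow> v i = 0) \<and>
   (\<exists>a\<in>euclid L. \<forall>b\<in>euclid L. height v b \<le> height v a)}"

definition peak :: "(nat \<Rightarrow> nat) \<Rightarrow> (nat \<Rightarrow> real)" where
  "peak v = (SOME a. a \<in> euclid L \<and> (\<forall>b\<in>euclid L. height v b \<le> height v a))"

text \<open>
  The Legendre transform of the penalised sum; it plays the part of the coefficients of the product of all
  polynomials.
\<close>

definition weight :: "(nat \<Rightarrow> nat) \<Rightarrow> real" where
  "weight v = height v (peak v)"

lemma peak:
  assumes "v \<in> newton_points"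
  shows "peak v \<in> euclid L" "\<And>b. b \<in> euclid L \<Longrightarrow> height v b \<le> height v (peak v)"
proof -
  have "peak v \<in> euclid L \<and> (\<forall>b\<in>euclid L. height v b \<le> height v (peak v))"
    unfolding peak_def
    by (rule someI_ex[of "\<lambda>a. a \<in> euclid L \<and> (\<forall>b\<in>euclid L. height v b \<le> height v a)"])
      (use assms[unfolded newton_points_def] in blast)
  then show "peak v \<in> euclid L" "\<And>b. b \<in> euclid L \<Longrightarrow> height v b \<le> height v (peak v)" by auto
qed

lemma continuous_on_height: "continuous_on X (height v)"
  unfolding height_def[abs_def]
  by (intro continuous_intros continuous_on_trop_val continuous_on_penalty continuous_on_dot)

lemma newton_pointI:
  assumes "\<forall>i. i \<notin> L \<longrightarrow> v i = 0" "\<delta> > 0" "\<And>a. a \<in> euclid L \<Longrightarrow> height v a \<le> C - \<delta> * l1 L a"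
  shows "v \<in> newton_points"
  using attains_max_if_coercive[OF finite_L continuous_on_height assms(2,3)] assms(1)
  by (auto simp: newton_points_def)

lemma sum_of_monomials_newton_point:
  assumes I: "\<And>j. j \<in> W \<Longrightarrow> I j \<in> S j"
  shows "(\<lambda>i. \<Sum>j\<in>W. I j i) \<in> newton_points"
proof (rule newton_pointI[where \<delta> = "1 / (card L + 1)" and C = "\<Sum>j\<in>W. c j (I j)"])
  show "\<forall>i. i \<notin> L \<longrightarrow> (\<Sum>j\<in>W. I j i) = 0" by (meson I S_support sum.neutral)
  fix a assume "a \<in> euclid L"
  have "dot L (\<lambda>i. \<Sum>j\<in>W. I j i) a = (\<Sum>j\<in>W. dot L (I j) a)"
    unfolding dot_def of_nat_sum sum_distrib_right by (rule sum.swap)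
  moreover have "(\<Sum>j\<in>W. trop_val j a) \<le> (\<Sum>j\<in>W. c j (I j) + dot L (I j) a)"
    using I by (intro sum_mono trop_val_le) auto
  ultimately show "height (\<lambda>i. \<Sum>j\<in>W. I j i) a \<le> (\<Sum>j\<in>W. c j (I j)) - 1 / (card L + 1) * l1 L a"
    using l1_le_penalty[of L a] unfolding height_def by (simp add: sum.distrib)
qed simp

text \<open>
  The height with the polynomial \<open>j\<close> replaced by its single monomial \<open>I\<close>.
\<close>

definition height_off :: "'j \<Rightarrow> (nat \<Rightarrow> nat) \<Rightarrow> (nat \<Rightarrow> nat) \<Rightarrow> (nat \<Rightarrow> real) \<Rightarrow> real" where
  "height_off j I v a = height v a - trop_val j a + c j I + dot L I a"

lemma height_off_eq:
  "j \<in> W \<Longrightarrow> height_off j I v a = 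
     (\<Sum>j'\<in>W - {j}. trop_val j' a) - penalty L a - dot L v a + c j I + dot L I a"
  unfolding height_off_def height_def by (simp add: sum.remove[OF finite_W, of j])

lemma height_off_strictly_concave:
  assumes "j \<in> W" and "a \<in> euclid L" "b \<in> euclid L" "a \<noteq> b" "0 < t" "t < 1"
  shows "(1 - t) * height_off j I v a + t * height_off j I v b < height_off j I v (seg t a b)"
proof -
  have "(1 - t) * (\<Sum>j'\<in>W - {j}. trop_val j' a) + t * (\<Sum>j'\<in>W - {j}. trop_val j' b)
      \<le> (\<Sum>j'\<in>W - {j}. trop_val j' (seg t a b))"
    unfolding sum_distrib_left sum.distrib[symmetric] using assms
    by (intro sum_mono trop_val_concave) auto
  then show ?thesis unfolding height_off_eq[OF assms(1)] dot_seg
    using penalty_strictly_convex[OF finite_L assms(2-)] by (simp add: algebra_simps)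
qed

lemma height_off_concave:
  assumes "j \<in> W" and "a \<in> euclid L" "b \<in> euclid L" "0 \<le> t" "t \<le> 1"
  shows "(1 - t) * height_off j I v a + t * height_off j I v b \<le> height_off j I v (seg t a b)"
proof (cases "a \<noteq> b \<and> 0 < t \<and> t < 1")
  case True
  then show ?thesis using height_off_strictly_concave[OF assms(1-3), of t I v] by simp
next
  case False
  then consider "a = b" | "t = 0" | "t = 1" using assms(4,5) by linarith
  then show ?thesis
  proof cases
    case 1
    have "seg t b b = b" by (simp add: seg_def algebra_simps)
    moreover have "(1 - t) * y + t * y = y" for y :: real by (simp add: algebra_simps)
    ultimately show ?thesis unfolding 1 by simp
  next
    case 2
    have "seg 0 a b = a" by (simp add: seg_def)
    then show ?thesis unfolding 2 by simp
  next
    case 3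
    have "seg 1 a b = b" by (simp add: seg_def)
    then show ?thesis unfolding 3 by simp
  qed
qed

lemma unique_min_near:
  assumes j: "j \<in> W" and I: "I \<in> S j"
    and min: "\<And>I'. I' \<in> S j \<Longrightarrow> I' \<noteq> I \<Longrightarrow> c j I + dot L I a < c j I' + dot L I' a"
  shows "\<exists>t. 0 < t \<and> t < 1 \<and> trop_val j (seg t a b) = c j I + dot L I (seg t a b)"
proof -
  have "\<forall>\<^sub>F t in at_right 0. \<forall>I'\<in>S j - {I}. c j I + dot L I (seg t a b) < c j I' + dot L I' (seg t a b)"
  proof (subst eventually_ball_finite_distrib)
    show "\<forall>I'\<in>S j - {I}. \<forall>\<^sub>F t in at_right 0. c j I + dot L I (seg t a b) < c j I' + dot L I' (seg t a b)"
    proof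
      fix I' assume I': "I' \<in> S j - {I}"
      let ?g = "\<lambda>K t. c j K + ((1 - t) * dot L K a + t * dot L K b)"
      have "((\<lambda>t. ?g I' t - ?g I t) \<longlongrightarrow> ?g I' 0 - ?g I 0) (at_right 0)"
        by (intro tendsto_intros)
      moreover have "?g I' 0 - ?g I 0 > 0" using min I' by simp
      ultimately have "\<forall>\<^sub>F t in at_right 0. ?g I' t - ?g I t > 0"
        by (rule order_tendstoD)
      then show "\<forall>\<^sub>F t in at_right 0. c j I + dot L I (seg t a b) < c j I' + dot L I' (seg t a b)"
        unfolding dot_seg by eventually_elim simp
    qed
  qed (use finite_S j in auto)
  moreover have "\<forall>\<^sub>F t in at_right (0::real). t \<in> {0<..<1}"
    by (rule eventually_at_right_real) simp
  ultimately have "\<forall>\<^sub>F t in at_right 0. t \<in> {0<..<1} \<and>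
      (\<forall>I'\<in>S j - {I}. c j I + dot L I (seg t a b) < c j I' + dot L I' (seg t a b))"
    by eventually_elim simp
  then obtain t where t: "t \<in> {0<..<1}"
      "\<forall>I'\<in>S j - {I}. c j I + dot L I (seg t a b) < c j I' + dot L I' (seg t a b)"
    using eventually_happens'[OF trivial_limit_at_right_real] by blast
  obtain I' where I': "I' \<in> S j" "trop_val j (seg t a b) = c j I' + dot L I' (seg t a b)"
    using trop_val_attained[OF j] by blast
  have "I' = I"
  proof (rule ccontr)
    assume "I' \<noteq> I"
    then have "c j I + dot L I (seg t a b) < c j I' + dot L I' (seg t a b)" using t(2) I'(1) by blast
    then show False using I'(2) trop_val_le[OF j I, of "seg t a b"] by linarith
  qed
  then show ?thesis using t(1) I' by auto
qed

text \<open>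
  The polynomial \<open>j\<close> and its monomial \<open>I\<close> are those with a unique minimum at the peak \<open>p\<close> of \<open>v\<close>. Around \<open>p\<close>
  the function \<open>height_off j I v\<close> coincides with the height, so \<open>p\<close> is a local, hence by strict concavity a
  strict global maximum of it. Moving \<open>p\<close> by a unit vector, or by the vector of ones, and comparing slopes
  gives \<open>I \<le> v\<close> and the degree bound. Since the height of \<open>v - I + I'\<close> is at most \<open>height_off j I v\<close> plus
  the difference of the coefficients, it decays linearly and attains its maximum, which for \<open>I' \<noteq> I\<close> lies strictly below
  the height of \<open>v\<close> at \<open>p\<close> plus that difference.
\<close>

theorem newton_point_step:
  assumes v: "v \<in> newton_points"
  shows "\<exists>j\<in>W. \<exists>I\<in>S j. (\<forall>i. I i \<le> v i) \<and>
    (\<Sum>i\<in>L. v i) + d j \<le> (\<Sum>i\<in>L. I i) + (\<Sum>j\<in>W. d j) \<and>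
    (\<forall>I'\<in>S j. (\<lambda>i. v i - I i + I' i) \<in> newton_points \<and>
       (I' \<noteq> I \<longrightarrow> weight (\<lambda>i. v i - I i + I' i) - weight v < c j I' - c j I))"
proof -
  define p where "p = peak v"
  have p: "p \<in> euclid L" and p_max: "\<And>b. b \<in> euclid L \<Longrightarrow> height v b \<le> height v p"
    using peak[OF v] by (auto simp: p_def)
  obtain j I where j: "j \<in> W" and I: "I \<in> S j"
    and min: "\<And>I'. I' \<in> S j \<Longrightarrow> I' \<noteq> I \<Longrightarrow> c j I + dot L I p < c j I' + dot L I' p"
    using no_root[of p] by blast
  let ?\<phi> = "height_off j I v"
  have val: "trop_val j p = c j I + dot L I p"
    using trop_val_attained[OF j, of p] trop_val_le[OF j I, of p] min by force
  have \<phi>p: "?\<phi> p = height v p" by (simp add: height_off_def val)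
  have strict: "?\<phi> b < ?\<phi> p" if b: "b \<in> euclid L" "b \<noteq> p" for b
  proof -
    obtain t where t: "0 < t" "t < 1" "trop_val j (seg t p b) = c j I + dot L I (seg t p b)"
      using unique_min_near[OF j I min] by blast
    have "(1 - t) * ?\<phi> p + t * ?\<phi> b < ?\<phi> (seg t p b)"
      using height_off_strictly_concave[OF j p b(1)] b(2) t by auto
    also have "\<dots> = height v (seg t p b)" by (simp add: height_off_def t(3))
    also have "\<dots> \<le> ?\<phi> p" unfolding \<phi>p by (intro p_max seg_in_euclid p b)
    finally have "t * ?\<phi> b < t * ?\<phi> p" by (simp add: algebra_simps)
    then show ?thesis using t by simp
  qed
  have val_mono: "trop_val j' a \<le> trop_val j' b" if j': "j' \<in> W" and ab: "\<And>i. i \<in> L \<Longrightarrow> a i \<le> b i" for j' a b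
  proof -
    obtain K where K: "K \<in> S j'" "trop_val j' b = c j' K + dot L K b"
      using trop_val_attained[OF j'] by blast
    have "dot L K a \<le> dot L K b" unfolding dot_def using ab by (intro sum_mono mult_left_mono) auto
    then show ?thesis using trop_val_le[OF j' K(1), of a] K(2) by simp
  qed
  have le: "I i \<le> v i" for i
  proof (cases "i \<in> L")
    case True
    \<comment> \<open>Exponents are nonnegative, so raising a coordinate does not lower the other polynomials.\<close>
    define b where "b = (\<lambda>k. p k + (if k = i then 1 else 0))"
    have b: "b \<in> euclid L" "b \<noteq> p" using p True by (auto simp: b_def euclid_def fun_eq_iff)
    have dot_b: "dot L K b = dot L K p + real (K i)" for K
      unfolding dot_def b_def using True finite_L
      by (simp add: algebra_simps sum.distrib if_distrib[of "\<lambda>x. _ * x"] cong: if_cong)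
    have "(\<Sum>j'\<in>W - {j}. trop_val j' p) \<le> (\<Sum>j'\<in>W - {j}. trop_val j' b)"
      by (intro sum_mono val_mono) (auto simp: b_def)
    moreover have "l1 L (\<lambda>k. b k - p k) = 1" using True finite_L by (simp add: l1_def b_def if_distrib[of abs] cong: if_cong)
    then have "penalty L b \<le> penalty L p + 1"
      using penalty_lipschitz[of L b p] by (smt (verit) divide_le_eq_1 of_nat_0_le_iff of_nat_1 of_nat_add)
    ultimately have "?\<phi> p + real (I i) - real (v i) - 1 \<le> ?\<phi> b"
      unfolding height_off_eq[OF j] dot_b by simp
    then have "real (I i) < real (v i) + 1" using strict[OF b] by simp
    then show ?thesis by linarith
  qed (use S_support[OF j I] in simp)
  have deg: "(\<Sum>i\<in>L. v i) + d j \<le> (\<Sum>i\<in>L. I i) + (\<Sum>j\<in>W. d j)"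
  proof -
    \<comment> \<open>Lowering all coordinates by one costs each of the other polynomials at most its degree.\<close>
    define b where "b = (\<lambda>k. if k \<in> L then p k - 1 else 0)"
    have b: "b \<in> euclid L" by (auto simp: b_def euclid_def)
    have dot_b: "dot L K b = dot L K p - real (\<Sum>i\<in>L. K i)" for K
      unfolding dot_def b_def by (simp add: algebra_simps sum_subtractf)
    have "trop_val j' p - real (d j') \<le> trop_val j' b" if j': "j' \<in> W" for j'
    proof -
      obtain K where K: "K \<in> S j'" "trop_val j' b = c j' K + dot L K b"
        using trop_val_attained[OF j'] by blast
      show ?thesis using trop_val_le[OF j' K(1), of p] S_degree[OF j' K(1)]
        unfolding K(2) dot_b by linarith
    qed
    then have "(\<Sum>j'\<in>W - {j}. trop_val j' p - real (d j')) \<le> (\<Sum>j'\<in>W - {j}. trop_val j' b)"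
      by (intro sum_mono) auto
    moreover have "l1 L (\<lambda>k. b k - p k) = card L" by (simp add: l1_def b_def)
    then have "l1 L (\<lambda>k. b k - p k) / (card L + 1) < 1" by simp
    then have "penalty L b < penalty L p + 1" using penalty_lipschitz[of L b p] by linarith
    moreover have "?\<phi> b \<le> ?\<phi> p" using strict[OF b] by (cases "b = p") auto
    ultimately have "real (\<Sum>i\<in>L. v i) < real (\<Sum>i\<in>L. I i) + real (\<Sum>j'\<in>W - {j}. d j') + 1"
      unfolding height_off_eq[OF j] dot_b by (simp add: sum_subtractf)
    then have "(\<Sum>i\<in>L. v i) \<le> (\<Sum>i\<in>L. I i) + (\<Sum>j'\<in>W - {j}. d j')" by linarith
    then show ?thesis using sum.remove[OF finite_W j, of d] by simp
  qed
  have "continuous_on (euclid L) ?\<phi>"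
    unfolding height_off_def[abs_def]
    by (intro continuous_intros continuous_on_height continuous_on_dot continuous_on_trop_val j)
  from coercive_if_strict_max[OF finite_L this height_off_concave[OF j] p strict]
  obtain \<delta> C where \<delta>: "\<delta> > 0" and C: "\<And>a. a \<in> euclid L \<Longrightarrow> ?\<phi> a \<le> C - \<delta> * l1 L a" by blast
  have move: "(\<lambda>i. v i - I i + I' i) \<in> newton_points \<and>
       (I' \<noteq> I \<longrightarrow> weight (\<lambda>i. v i - I i + I' i) - weight v < c j I' - c j I)"
    if I': "I' \<in> S j" for I'
  proof -
    let ?v' = "\<lambda>i. v i - I i + I' i"
    have "dot L ?v' a = dot L v a - dot L I a + dot L I' a" for a
    proof -
      have "real (v i - I i + I' i) = real (v i) - real (I i) + real (I' i)" for i
        using le[of i] by simp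
      then show ?thesis
        unfolding dot_def sum.distrib[symmetric] sum_subtractf[symmetric]
        by (simp add: left_diff_distrib distrib_right del: of_nat_add)
    qed
    then have h: "height ?v' a = ?\<phi> a + trop_val j a - c j I - dot L I' a" for a
      unfolding height_off_def height_def by simp
    then have h_le: "height ?v' a \<le> ?\<phi> a + c j I' - c j I" for a
      using trop_val_le[OF j I', of a] by simp
    have v': "?v' \<in> newton_points"
    proof (rule newton_pointI[OF _ \<delta>])
      show "\<forall>i. i \<notin> L \<longrightarrow> ?v' i = 0"
        using v S_support[OF j I'] by (auto simp: newton_points_def)
      show "height ?v' a \<le> (C + c j I' - c j I) - \<delta> * l1 L a" if "a \<in> euclid L" for a
        using C[OF that] h_le[of a] by simp
    qed
    moreover have "weight ?v' - weight v < c j I' - c j I" if "I' \<noteq> I"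
    \<comment> \<open>At the peak \<open>p\<close> itself the inequality is strict because the minimum is unique, elsewhere because \<open>p\<close> is the
      only maximiser.\<close>
    proof (cases "peak ?v' = p")
      case True
      then show ?thesis using min[OF I' that] by (simp add: weight_def p_def[symmetric] h val \<phi>p)
    next
      case False
      then have "?\<phi> (peak ?v') < ?\<phi> p" using strict peak(1)[OF v'] by blast
      then show ?thesis using h_le[of "peak ?v'"] by (simp add: weight_def p_def[symmetric] \<phi>p)
    qed
    ultimately show ?thesis by blast
  qed
  show ?thesis using j I le deg move by blast
qed

lemma finite_newton_points: "finite newton_points"
proof (rule finite_subset)
  let ?D = "\<Sum>j\<in>W. d j"
  show "newton_points \<subseteq> {v. v ` L \<subseteq> {..?D} \<and> (\<forall>i. i \<notin> L \<longrightarrow> v i = 0)}"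
  proof safe
    fix v i assume v: "v \<in> newton_points"
    show "v i = 0" if "i \<notin> L" using v that by (auto simp: newton_points_def)
    assume i: "i \<in> L"
    obtain j I where "j \<in> W" "I \<in> S j" "(\<Sum>i\<in>L. v i) + d j \<le> (\<Sum>i\<in>L. I i) + ?D"
      using newton_point_step[OF v] by blast
    moreover have "(\<Sum>i\<in>L. I i) \<le> d j" using S_degree calculation by blast
    moreover have "v i \<le> (\<Sum>i\<in>L. v i)" using i finite_L by (intro member_le_sum) auto
    ultimately show "v i \<le> ?D" by linarith
  qed
  have "finite {v. \<forall>i. (i \<in> L \<longrightarrow> v i \<in> {..?D}) \<and> (i \<notin> L \<longrightarrow> v i = 0)}"
    using finite_L by (intro finite_set_of_finite_funs) auto
  then show "finite {v. v ` L \<subseteq> {..?D} \<and> (\<forall>i. i \<notin> L \<longrightarrow> v i = 0)}"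
    by (rule rev_finite_subset) auto
qed

end

section \<open>Vanishing, supports and points with infinite coordinates\<close>

lemma exp_deg_add: "exp_deg n (\<lambda>i. a i + b i) = exp_deg n a + exp_deg n b"
  by (simp add: exp_deg_def sum.distrib)

text \<open>
  The form of tropical vanishing used throughout: it avoids the infimum and treats the value \<open>\<infinity>\<close> uniformly.
\<close>

lemma trop_vanishes_iff:
  assumes S: "finite S"
  shows "trop_vanishes S v \<longleftrightarrow> (\<forall>i\<in>S. v i \<noteq> \<infinity> \<longrightarrow> (\<exists>l\<in>S. l \<noteq> i \<and> v l \<le> v i))"
proof
  assume van: "trop_vanishes S v"
  show "\<forall>i\<in>S. v i \<noteq> \<infinity> \<longrightarrow> (\<exists>l\<in>S. l \<noteq> i \<and> v l \<le> v i)"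
  proof (intro ballI impI)
    fix i assume i: "i \<in> S" "v i \<noteq> \<infinity>"
    have le: "(INF l\<in>S. v l) \<le> v i" using i(1) by (rule INF_lower)
    then have "(INF l\<in>S. v l) \<noteq> \<infinity>" using i(2) by auto
    then obtain p q where "p \<in> S" "q \<in> S" "p \<noteq> q"
        "v p = (INF l\<in>S. v l)" "v q = (INF l\<in>S. v l)"
      using van unfolding trop_vanishes_def by blast
    then show "\<exists>l\<in>S. l \<noteq> i \<and> v l \<le> v i" using le by metis
  qed
next
  assume R: "\<forall>i\<in>S. v i \<noteq> \<infinity> \<longrightarrow> (\<exists>l\<in>S. l \<noteq> i \<and> v l \<le> v i)"
  show "trop_vanishes S v"
  proof (cases "\<forall>i\<in>S. v i = \<infinity>")
    case True
    then have "(INF l\<in>S. v l) = \<infinity>"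
      by (metis INF_eqI INF_greatest ereal_infty_less_eq(1) order_refl top_ereal_def top_greatest)
    then show ?thesis by (simp add: trop_vanishes_def)
  next
    case False
    then obtain i where i: "i \<in> S" "v i \<noteq> \<infinity>" by blast
    have "S \<noteq> {}" using i(1) by blast
    then have "Min (v ` S) \<in> v ` S" using S by (intro Min_in) auto
    then obtain p where p: "p \<in> S" "v p = Min (v ` S)" by auto
    have p_le: "v p \<le> v l" if "l \<in> S" for l using that S p(2) by simp
    have inf: "(INF l\<in>S. v l) = v p"
      using p(1) p_le by (intro antisym INF_lower INF_greatest) auto
    have "v p \<noteq> \<infinity>" using p_le[OF i(1)] i(2) by auto
    then obtain l where "l \<in> S" "l \<noteq> p" "v l \<le> v p" using R p(1) by blast
    then show ?thesis unfolding trop_vanishes_def inf using p(1) p_le by (metis antisym)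
  qed
qed

text \<open>
  A monomial that is present with coefficient \<open>\<infinity>\<close> counts for the degree, but it neither attains a
  finite minimum nor contributes a finite matrix entry.
\<close>

definition finite_support :: "trop_poly \<Rightarrow> (nat \<Rightarrow> nat) set" where
  "finite_support f = {I \<in> dom f. trop_coeff f I \<noteq> \<infinity>}"

lemma finite_macaulay_cols: "finite (macaulay_cols n N)"
proof -
  let ?B = "{I. \<forall>i. (i \<in> {..<n} \<longrightarrow> I i \<in> {..N}) \<and> (i \<notin> {..<n} \<longrightarrow> I i = 0)}"
  have "I i \<le> exp_deg n I" if "i < n" for I i
    unfolding exp_deg_def using that by (intro member_le_sum) auto
  then have "macaulay_cols n N \<subseteq> ?B"
    by (auto simp: macaulay_cols_def exponents_def intro: le_trans)
  moreover have "finite ?B" by (intro finite_set_of_finite_funs finite_lessThan finite_atMost)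
  ultimately show ?thesis by (rule finite_subset)
qed

lemma macaulay_shift: "macaulay F (j, J) (\<lambda>i. J i + I i) = trop_coeff (F ! j) I"
  by (simp add: macaulay_def monom_times_def trop_coeff_def)

lemma macaulay_finite_entry:
  assumes "macaulay F (j, J) K \<noteq> \<infinity>"
  obtains I where "I \<in> finite_support (F ! j)" "K = (\<lambda>i. J i + I i)"
proof
  have le: "J i \<le> K i" for i
    using assms by (auto simp: macaulay_def monom_times_def trop_coeff_def split: if_splits)
  then show K: "K = (\<lambda>i. J i + (K i - J i))" by (auto simp: fun_eq_iff)
  have "trop_coeff (F ! j) (\<lambda>i. K i - J i) \<noteq> \<infinity>" using assms macaulay_shift[of F j J] K by metis
  then show "(\<lambda>i. K i - J i) \<in> finite_support (F ! j)"
    by (auto simp: finite_support_def trop_coeff_def split: option.splits)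
qed

definition extend_infty :: "nat set \<Rightarrow> (nat \<Rightarrow> real) \<Rightarrow> nat \<Rightarrow> ereal" where
  "extend_infty L a i = (if i \<in> L then ereal (a i) else \<infinity>)"

lemma exp_eval_extend_infty:
  assumes L: "L \<subseteq> {..<n}"
  shows "I \<in> exponents n \<Longrightarrow> \<forall>i. i \<notin> L \<longrightarrow> I i = 0 \<Longrightarrow> exp_eval n I (extend_infty L a) = ereal (dot L I a)"
    and "I \<in> exponents n \<Longrightarrow> \<not> (\<forall>i. i \<notin> L \<longrightarrow> I i = 0) \<Longrightarrow> exp_eval n I (extend_infty L a) = \<infinity>"
proof -
  assume I: "\<forall>i. i \<notin> L \<longrightarrow> I i = 0"
  have "exp_eval n I (extend_infty L a) = (\<Sum>i<n. ereal (if i \<in> L then real (I i) * a i else 0))"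
    unfolding exp_eval_def extend_infty_def using I by (intro sum.cong) (auto simp: zero_ereal_def[symmetric])
  also have "\<dots> = ereal (dot L I a)"
    unfolding dot_def sum_ereal by (simp add: sum.If_cases Int_absorb1[OF L])
  finally show "exp_eval n I (extend_infty L a) = ereal (dot L I a)" .
next
  assume I: "I \<in> exponents n" "\<not> (\<forall>i. i \<notin> L \<longrightarrow> I i = 0)"
  then obtain i where i: "i \<notin> L" "I i \<noteq> 0" by blast
  then have "i < n" using I(1) unfolding exponents_def by (metis (mono_tags) mem_Collect_eq not_le)
  moreover have "ereal (real (I i)) * extend_infty L a i = \<infinity>" using i by (simp add: extend_infty_def)
  ultimately show "exp_eval n I (extend_infty L a) = \<infinity>" unfolding exp_eval_def sum_Pinfty by blast
qed

section \<open>Escaping from a coordinate face\<close>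

text \<open>
  Real solutions and systems with real coefficients are a special case of this setting, so it serves both
  parts of the theorem.
\<close>

locale solved_macaulay_system =
  fixes n :: nat and F :: "trop_poly list" and N :: nat and y :: "(nat \<Rightarrow> nat) \<Rightarrow> ereal"
  assumes polys: "\<And>f. f \<in> set F \<Longrightarrow> is_trop_poly trop_Rinf n f"
    and sol: "macaulay_solution trop_Rinf n F N y"
begin

definition face :: "nat set \<Rightarrow> nat \<Rightarrow> (nat \<Rightarrow> nat) set" where
  "face L j = {I \<in> finite_support (F ! j). \<forall>i. i \<notin> L \<longrightarrow> I i = 0}"

definition active :: "nat set \<Rightarrow> nat set" where
  "active L = {j. j < length F \<and> face L j \<noteq> {}}"

definition real_coeff :: "nat \<Rightarrow> (nat \<Rightarrow> nat) \<Rightarrow> real" where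
  "real_coeff j I = real_of_ereal (trop_coeff (F ! j) I)"

definition deg :: "nat \<Rightarrow> nat" where
  "deg j = trop_deg n (F ! j)"

text \<open>
  Setting the variables outside \<open>L\<close> to \<open>\<infinity>\<close> reduces the system to its restriction to \<open>L\<close>: inactive
  polynomials take the value \<open>\<infinity>\<close> and so vanish.
\<close>

definition rootless_on :: "nat set \<Rightarrow> bool" where
  "rootless_on L \<longleftrightarrow> L \<subseteq> {..<n} \<and> (\<forall>a. \<exists>f\<in>set F. \<not> is_root n f (extend_infty L a))"

abbreviation newton :: "nat set \<Rightarrow> (nat \<Rightarrow> nat) set" where
  "newton L \<equiv> rootless_system.newton_points L (active L) (face L) real_coeff"

lemma poly_nth: "j < length F \<Longrightarrow> is_trop_poly trop_Rinf n (F ! j)"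
  using polys by simp

lemma support_exponents: "j < length F \<Longrightarrow> I \<in> finite_support (F ! j) \<Longrightarrow> I \<in> exponents n"
  using poly_nth by (auto simp: is_trop_poly_def finite_support_def)

lemma support_degree: "j < length F \<Longrightarrow> I \<in> finite_support (F ! j) \<Longrightarrow> exp_deg n I \<le> deg j"
  unfolding deg_def trop_deg_def using poly_nth[of j]
  by (intro Max_ge) (auto simp: finite_support_def is_trop_poly_def)

lemma coeff_real:
  assumes "j < length F" "I \<in> finite_support (F ! j)"
  shows "trop_coeff (F ! j) I = ereal (real_coeff j I)"
proof -
  have "trop_coeff (F ! j) I \<in> ran (F ! j)"
    using assms(2) by (auto simp: finite_support_def trop_coeff_def ran_def)
  then have "trop_coeff (F ! j) I \<noteq> -\<infinity>"
    using poly_nth[OF assms(1)] by (auto simp: is_trop_poly_def trop_Rinf_def)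
  then show ?thesis using assms(2)
    unfolding real_coeff_def finite_support_def by (cases "trop_coeff (F ! j) I") auto
qed

lemma y_not_minfty: "I \<in> macaulay_cols n N \<Longrightarrow> y I \<noteq> -\<infinity>"
  using sol by (auto simp: macaulay_solution_def is_lin_solution_def trop_Rinf_def)

lemma rootless_system:
  assumes "rootless_on L"
  shows "rootless_system L (active L) (face L) real_coeff deg"
proof
  have L: "L \<subseteq> {..<n}" using assms by (simp add: rootless_on_def)
  then show "finite L" by (rule finite_subset) simp
  show "finite (active L)" by (simp add: active_def)
  show "finite (face L j)" "face L j \<noteq> {}" if "j \<in> active L" for j
    using poly_nth[of j] that by (auto simp: active_def face_def finite_support_def is_trop_poly_def)
  show "I i = 0" if "j \<in> active L" "I \<in> face L j" "i \<notin> L" for j I i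
    using that by (auto simp: face_def)
  show "(\<Sum>i\<in>L. I i) \<le> deg j" if "j \<in> active L" "I \<in> face L j" for j I
  proof -
    have "(\<Sum>i\<in>L. I i) \<le> exp_deg n I" unfolding exp_deg_def using L by (intro sum_mono2) auto
    then show ?thesis using support_degree[of j I] that by (auto simp: active_def face_def)
  qed
  show "\<exists>j\<in>active L. \<exists>I\<in>face L j. \<forall>I'\<in>face L j. I' \<noteq> I \<longrightarrow>
      real_coeff j I + dot L I a < real_coeff j I' + dot L I' a" for a
  proof -
    obtain j where j: "j < length F" "\<not> is_root n (F ! j) (extend_infty L a)"
      using assms unfolding rootless_on_def by (metis in_set_conv_nth)
    let ?v = "\<lambda>I. trop_coeff (F ! j) I + exp_eval n I (extend_infty L a)"
    have "finite (dom (F ! j))" using poly_nth[OF j(1)] by (simp add: is_trop_poly_def)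
    from j(2)[unfolded is_root_def trop_vanishes_iff[OF this]]
    obtain I where I: "I \<in> dom (F ! j)" "?v I \<noteq> \<infinity>"
      and less: "\<And>l. l \<in> dom (F ! j) \<Longrightarrow> l \<noteq> I \<Longrightarrow> ?v I < ?v l" by force
    have In: "I \<in> exponents n" using I(1) poly_nth[OF j(1)] by (auto simp: is_trop_poly_def)
    have "exp_eval n I (extend_infty L a) \<noteq> \<infinity>" "trop_coeff (F ! j) I \<noteq> \<infinity>" using I(2) by auto
    then have If: "I \<in> face L j"
      using I(1) exp_eval_extend_infty(2)[OF L In, of a] unfolding face_def finite_support_def by blast
    have val: "?v K = ereal (real_coeff j K + dot L K a)" if K: "K \<in> face L j" for K
    proof -
      have "K \<in> finite_support (F ! j)" "\<forall>i. i \<notin> L \<longrightarrow> K i = 0" using K by (auto simp: face_def)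
      then show ?thesis
        using exp_eval_extend_infty(1)[OF L support_exponents[OF j(1)], of K a] coeff_real[OF j(1)] by simp
    qed
    have "\<forall>I'\<in>face L j. I' \<noteq> I \<longrightarrow> real_coeff j I + dot L I a < real_coeff j I' + dot L I' a"
    proof (intro ballI impI)
      fix I' assume I': "I' \<in> face L j" "I' \<noteq> I"
      then have "?v I < ?v I'" by (intro less) (auto simp: face_def finite_support_def)
      then show "real_coeff j I + dot L I a < real_coeff j I' + dot L I' a"
        unfolding val[OF If] val[OF I'(1)] by simp
    qed
    moreover have "j \<in> active L" using j(1) If by (auto simp: active_def)
    ultimately show ?thesis using If by blast
  qed
qed

text \<open>
  Let \<open>v\<close> minimise weight plus \<open>y\<close> over the translate of the Newton points by \<open>s\<close>. The shifted row provided by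
  \<open>newton_point_step\<close> is finite at \<open>s + v\<close>, so its minimum occurs in a second column. A column inside the
  translate would contradict minimality, so the second monomial \<open>I\<close> involves a variable outside \<open>L\<close>. The closure
  statement for all monomials of the face lets the next application start from a translate whose base
  differs from \<open>s\<close> by only one monomial.
\<close>

theorem leave_face:
  assumes L: "rootless_on L" and s: "s \<in> exponents n"
    and deg_le: "exp_deg n s + (\<Sum>j\<in>active L. deg j) \<le> N"
    and start: "v\<^sub>0 \<in> newton L" "y (\<lambda>i. s i + v\<^sub>0 i) \<noteq> \<infinity>"
  shows "\<exists>j\<in>active L. \<exists>v\<in>newton L. \<exists>I\<^sub>0\<in>face L j. \<exists>I\<in>finite_support (F ! j) - face L j.
    (\<forall>i. I\<^sub>0 i \<le> v i) \<and> (\<forall>I'\<in>face L j. (\<lambda>i. v i - I\<^sub>0 i + I' i) \<in> newton L) \<and>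
    y (\<lambda>i. s i + (v i - I\<^sub>0 i) + I i) \<noteq> \<infinity>"
proof -
  interpret R: rootless_system L "active L" "face L" real_coeff deg using rootless_system[OF L] .
  have Ln: "L \<subseteq> {..<n}" using L by (simp add: rootless_on_def)
  have supp: "v i = 0" if "v \<in> newton L" "i \<notin> L" for v i
    using that by (auto simp: R.newton_points_def)
  have deg_L: "exp_deg n v = (\<Sum>i\<in>L. v i)" if "\<And>i. i \<notin> L \<Longrightarrow> v i = 0" for v
    unfolding exp_deg_def using Ln that by (intro sum.mono_neutral_right) auto
  have cols: "(\<lambda>i. s i + v i) \<in> macaulay_cols n N" if v: "v \<in> newton L" for v
  proof -
    obtain j I where j: "j \<in> active L" "I \<in> face L j"
      "(\<Sum>i\<in>L. v i) + deg j \<le> (\<Sum>i\<in>L. I i) + (\<Sum>j\<in>active L. deg j)"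
      using R.newton_point_step[OF v] by blast
    have "exp_deg n v \<le> (\<Sum>j\<in>active L. deg j)"
      using j(3) R.S_degree[OF j(1,2)] deg_L[OF supp[OF v]] by simp
    moreover have "v i = 0" if "i \<ge> n" for i using supp[OF v, of i] subsetD[OF Ln, of i] that by fastforce
    ultimately show ?thesis
      using s deg_le exp_deg_add[of n s v] by (simp add: macaulay_cols_def exponents_def)
  qed
  \<comment> \<open>Infinite entries of the solution are excluded so that the minimisation is over real numbers.\<close>
  define T where "T = {v \<in> newton L. y (\<lambda>i. s i + v i) \<noteq> \<infinity>}"
  let ?\<psi> = "\<lambda>v. R.weight v + real_of_ereal (y (\<lambda>i. s i + v i))"
  have "finite T" unfolding T_def using R.finite_newton_points by simp
  moreover have "T \<noteq> {}" using start by (auto simp: T_def)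
  ultimately obtain v where v: "v \<in> T" and v_min: "\<And>u. u \<in> T \<Longrightarrow> ?\<psi> v \<le> ?\<psi> u"
    using ex_is_arg_min_if_finite[of T ?\<psi>] unfolding is_arg_min_def by force
  have vV: "v \<in> newton L" and yv: "y (\<lambda>i. s i + v i) \<noteq> \<infinity>" using v by (auto simp: T_def)
  obtain j I\<^sub>0 where j: "j \<in> active L" and I0: "I\<^sub>0 \<in> face L j" and le: "\<forall>i. I\<^sub>0 i \<le> v i"
    and deg_v: "(\<Sum>i\<in>L. v i) + deg j \<le> (\<Sum>i\<in>L. I\<^sub>0 i) + (\<Sum>j\<in>active L. deg j)"
    and move: "\<And>I'. I' \<in> face L j \<Longrightarrow> (\<lambda>i. v i - I\<^sub>0 i + I' i) \<in> newton L \<and>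
       (I' \<noteq> I\<^sub>0 \<longrightarrow> R.weight (\<lambda>i. v i - I\<^sub>0 i + I' i) - R.weight v < real_coeff j I' - real_coeff j I\<^sub>0)"
    using R.newton_point_step[OF vV] by blast
  have jF: "j < length F" using j by (simp add: active_def)
  have I0f: "I\<^sub>0 \<in> finite_support (F ! j)" using I0 by (simp add: face_def)
  define J where "J = (\<lambda>i. s i + (v i - I\<^sub>0 i))"
  have "v i = 0" if "i \<ge> n" for i using supp[OF vV, of i] subsetD[OF Ln, of i] that by fastforce
  then have Jn: "J \<in> exponents n" using s by (simp add: J_def exponents_def)
  have v_eq: "(\<lambda>i. s i + v i) = (\<lambda>i. J i + I\<^sub>0 i)" using le by (simp add: J_def fun_eq_iff trans_le_add2)
  have "exp_deg n v = exp_deg n (\<lambda>i. v i - I\<^sub>0 i) + exp_deg n I\<^sub>0"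
    unfolding exp_deg_add[symmetric] using le by simp
  moreover have "exp_deg n I\<^sub>0 = (\<Sum>i\<in>L. I\<^sub>0 i)" using R.S_support[OF j I0] by (intro deg_L) auto
  ultimately have degJ: "exp_deg n J + deg j \<le> N"
    using deg_v deg_L[OF supp[OF vV]] deg_le exp_deg_add[of n s "\<lambda>i. v i - I\<^sub>0 i"] unfolding J_def by simp
  have row: "(j, J) \<in> macaulay_rows n F N"
  proof -
    have "I \<in> macaulay_cols n N" if I: "I \<in> exponents n" "macaulay F (j, J) I \<noteq> \<infinity>" for I
    proof -
      obtain I' where "I' \<in> finite_support (F ! j)" "I = (\<lambda>i. J i + I' i)"
        using macaulay_finite_entry[OF I(2)] .
      then show ?thesis using I(1) degJ support_degree[OF jF] exp_deg_add[of n J I']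
        by (fastforce simp: macaulay_cols_def)
    qed
    then show ?thesis using jF Jn by (auto simp: macaulay_rows_def)
  qed
  let ?val = "\<lambda>K. macaulay F (j, J) K + y K"
  have "trop_vanishes (macaulay_cols n N) ?val"
    using sol row by (auto simp: macaulay_solution_def is_lin_solution_def)
  note van = this[unfolded trop_vanishes_iff[OF finite_macaulay_cols]]
  have val0: "?val (\<lambda>i. s i + v i) = ereal (real_coeff j I\<^sub>0 + real_of_ereal (y (\<lambda>i. s i + v i)))"
    unfolding v_eq macaulay_shift coeff_real[OF jF I0f] 
    using y_not_minfty[OF cols[OF vV]] yv unfolding v_eq
    by (cases "y (\<lambda>i. J i + I\<^sub>0 i)") auto
  then have "?val (\<lambda>i. s i + v i) \<noteq> \<infinity>" by simp
  then obtain K where K: "K \<in> macaulay_cols n N" "K \<noteq> (\<lambda>i. s i + v i)"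
      "?val K \<le> ?val (\<lambda>i. s i + v i)"
    using van cols[OF vV] by blast
  have "macaulay F (j, J) K \<noteq> \<infinity>" "y K \<noteq> \<infinity>" using K(3) unfolding val0 by auto
  then obtain I where I: "I \<in> finite_support (F ! j)" and KI: "K = (\<lambda>i. J i + I i)" and yK: "y K \<noteq> \<infinity>"
    using macaulay_finite_entry by blast
  have II0: "I \<noteq> I\<^sub>0" using K(2) unfolding KI v_eq by auto
  have valK: "?val K = ereal (real_coeff j I + real_of_ereal (y K))"
    using y_not_minfty[OF K(1)] yK unfolding KI macaulay_shift coeff_real[OF jF I]
    by (cases "y (\<lambda>i. J i + I i)") auto
  have drop: "real_coeff j I + real_of_ereal (y K)
      \<le> real_coeff j I\<^sub>0 + real_of_ereal (y (\<lambda>i. s i + v i))"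
    using K(3) unfolding val0 valK by simp
  have "I \<notin> face L j"
  proof
    assume If: "I \<in> face L j"
    have eq: "(\<lambda>i. s i + (v i - I\<^sub>0 i + I i)) = K" unfolding KI J_def by auto
    have "(\<lambda>i. v i - I\<^sub>0 i + I i) \<in> T" unfolding T_def using move[OF If] eq yK by simp
    from v_min[OF this] show False using move[OF If] II0 drop unfolding eq by simp
  qed
  moreover have "y (\<lambda>i. s i + (v i - I\<^sub>0 i) + I i) \<noteq> \<infinity>" using yK unfolding KI J_def .
  ultimately show ?thesis using j vV I0 I le move by blast
qed

end

section \<open>Trading stock for new variables\<close>

context solved_macaulay_system
begin

text \<open>
  The set \<open>L'\<close> holds the stock. As every polynomial active on \<open>L\<close> is active on \<open>L'\<close>, it has a monomial \<open>M j\<close>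
  that can be paid from stock alone. Subtracting all \<open>M j\<close> from \<open>t\<close> gives a base \<open>s\<close> such that \<open>t\<close> lies in the
  translate of the Newton points by \<open>s\<close>. Each use of \<open>leave_face\<close> changes the base by \<open>- M j + I\<close>, where \<open>I\<close>
  contains a variable outside \<open>L\<close>. After \<open>k\<close> uses the stock has lost degree at most \<open>k * d\<close> initially and \<open>k * d\<close>
  on the way, while the other variables have gained degree at least \<open>k\<close>. The excess of a gained monomial is
  dropped, so that \<open>gain\<close> has degree exactly \<open>k\<close> and cannot overshoot a level.
\<close>

lemma trade_for_new_variables:
  assumes L: "rootless_on L" and k: "k = length F"
    and d: "\<And>j. j < k \<Longrightarrow> deg j \<le> d"
    and t: "t \<in> exponents n" "y t \<noteq> \<infinity>" "exp_deg n t + 2 * k * d \<le> N"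
    and stock: "\<And>i. i \<in> L' \<Longrightarrow> 2 * k * d \<le> t i" and "L' \<subseteq> L"
    and active: "active L \<subseteq> active L'"
  shows "\<exists>t' loss gain. t' \<in> exponents n \<and> y t' \<noteq> \<infinity> \<and> exp_deg n t' \<le> exp_deg n t + 2 * k * d \<and>
     (\<forall>i. t i + gain i \<le> t' i + loss i) \<and>
     (\<forall>i. i \<notin> L' \<longrightarrow> loss i = 0) \<and> exp_deg n loss \<le> 2 * k * d \<and>
     (\<forall>i. i \<in> L \<longrightarrow> gain i = 0) \<and> exp_deg n gain = k"
proof -
  interpret R: rootless_system L "active L" "face L" real_coeff deg using rootless_system[OF L] .
  have Ln: "L \<subseteq> {..<n}" using L by (simp add: rootless_on_def)
  have jk: "j < k" if "j \<in> active L" for j using that k by (simp add: active_def)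
  have "\<forall>j\<in>active L. \<exists>I. I \<in> face L' j" using active by (auto simp: active_def)
  then obtain M where M: "\<And>j. j \<in> active L \<Longrightarrow> M j \<in> face L' j" by metis
  have M_face: "M j \<in> face L j" if "j \<in> active L" for j using M[OF that] \<open>L' \<subseteq> L\<close> by (auto simp: face_def)
  have M0: "M j i = 0" if "j \<in> active L" "i \<notin> L'" for j i using M[OF that(1)] that(2) by (simp add: face_def)
  have degf: "exp_deg n I \<le> d" if "j \<in> active L" "I \<in> finite_support (F ! j)" for j I
    using support_degree[of j I] d[OF jk[OF that(1)]] jk[OF that(1)] that(2) k by simp
  have degM: "exp_deg n (M j) \<le> d" if "j \<in> active L" for j
    using degf[OF that] M_face[OF that] by (simp add: face_def)
  have Md: "M j i \<le> d" if "j \<in> active L" for j i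
  proof (cases "i < n")
    case True
    then have "M j i \<le> exp_deg n (M j)" unfolding exp_deg_def by (intro member_le_sum) auto
    then show ?thesis using degM[OF that] by simp
  next
    case False
    then show ?thesis using M0[OF that, of i] Ln \<open>L' \<subseteq> L\<close> by force
  qed
  have card: "card (active L) \<le> k"
    using card_mono[of "{..<k}" "active L"] jk by auto
  have sum_le: "(\<Sum>j\<in>active L. g j) \<le> k * d" if "\<And>j. j \<in> active L \<Longrightarrow> g j \<le> d" for g
  proof -
    have "(\<Sum>j\<in>active L. g j) \<le> card (active L) * d"
      using sum_bounded_above[of "active L" g d] that by simp
    then show ?thesis using mult_le_mono1[OF card] by (rule le_trans)
  qed
  have deg_sum: "(\<Sum>j\<in>active L. deg j) \<le> k * d" using d jk by (intro sum_le) auto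
  define v\<^sub>0 where "v\<^sub>0 = (\<lambda>i. \<Sum>j\<in>active L. M j i)"
  have v0V: "v\<^sub>0 \<in> newton L" unfolding v\<^sub>0_def by (intro R.sum_of_monomials_newton_point M_face)
  have v00: "v\<^sub>0 i = 0" if "i \<notin> L'" for i unfolding v\<^sub>0_def using M0 that by simp
  have v0t: "v\<^sub>0 i \<le> t i" for i
  proof (cases "i \<in> L'")
    case True
    have "v\<^sub>0 i \<le> k * d" unfolding v\<^sub>0_def by (intro sum_le Md)
    then show ?thesis using stock[OF True] by simp
  qed (simp add: v00)
  have degv0: "exp_deg n v\<^sub>0 \<le> k * d"
  proof -
    have "exp_deg n v\<^sub>0 = (\<Sum>j\<in>active L. exp_deg n (M j))"
      unfolding v\<^sub>0_def exp_deg_def by (rule sum.swap)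
    then show ?thesis using sum_le[OF degM] by simp
  qed
  have run: "\<exists>s v loss gain. s \<in> exponents n \<and> v \<in> newton L \<and> y (\<lambda>i. s i + v i) \<noteq> \<infinity> \<and>
     exp_deg n s \<le> exp_deg n t + q * d \<and>
     (\<forall>i. t i + gain i \<le> s i + loss i) \<and>
     (\<forall>i. i \<notin> L' \<longrightarrow> loss i = 0) \<and> exp_deg n loss \<le> (k + q) * d \<and>
     (\<forall>i. i \<in> L \<longrightarrow> gain i = 0) \<and> exp_deg n gain = q" if "q \<le> k" for q
    using that
  proof (induction q)
    case 0
    have eq: "(\<lambda>i. t i - v\<^sub>0 i + v\<^sub>0 i) = t" using v0t by auto
    have "exp_deg n (\<lambda>i. t i - v\<^sub>0 i) \<le> exp_deg n t" unfolding exp_deg_def by (intro sum_mono) auto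
    then show ?case using t v0V eq v0t v00 degv0
      by (intro exI[of _ "\<lambda>i. t i - v\<^sub>0 i"] exI[of _ v\<^sub>0] exI[of _ "\<lambda>_. 0"])
        (auto simp: exponents_def exp_deg_def)
  next
    case (Suc q)
    then obtain s v loss gain where s: "s \<in> exponents n" and v: "v \<in> newton L" "y (\<lambda>i. s i + v i) \<noteq> \<infinity>"
      and deg_s: "exp_deg n s \<le> exp_deg n t + q * d"
      and bal: "\<And>i. t i + gain i \<le> s i + loss i"
      and loss: "\<And>i. i \<notin> L' \<Longrightarrow> loss i = 0" "exp_deg n loss \<le> (k + q) * d"
      and gain: "\<And>i. i \<in> L \<Longrightarrow> gain i = 0" "exp_deg n gain = q"
      by auto
    have "Suc q * d \<le> k * d" using Suc.prems by (rule mult_le_mono1)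
    then have qk: "q * d + d \<le> k * d" by simp
    have "exp_deg n s + (\<Sum>j\<in>active L. deg j) \<le> N"
      using deg_s deg_sum qk t(3) by (simp add: algebra_simps)
    from leave_face[OF L s this v] obtain j u I\<^sub>0 I where j: "j \<in> active L" and u: "u \<in> newton L"
      and I0: "I\<^sub>0 \<in> face L j" and I: "I \<in> finite_support (F ! j)" "I \<notin> face L j"
      and le: "\<And>i. I\<^sub>0 i \<le> u i" and move: "\<And>I'. I' \<in> face L j \<Longrightarrow> (\<lambda>i. u i - I\<^sub>0 i + I' i) \<in> newton L"
      and y: "y (\<lambda>i. s i + (u i - I\<^sub>0 i) + I i) \<noteq> \<infinity>" by blast
    have In: "I \<in> exponents n" using support_exponents[OF _ I(1)] jk[OF j] k by simp
    obtain z where z: "z \<notin> L" "I z \<noteq> 0" using I by (auto simp: face_def)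
    have zn: "z < n" using In z(2) unfolding exponents_def by (metis (mono_tags) mem_Collect_eq not_le)
    have Ms: "M j i \<le> s i" for i
    proof (cases "i \<in> L'")
      case True
      then have "i < n" using \<open>L' \<subseteq> L\<close> Ln by auto
      then have "loss i \<le> exp_deg n loss" unfolding exp_deg_def by (intro member_le_sum) auto
      then have "loss i + d \<le> 2 * k * d" using loss(2) qk by (simp add: algebra_simps)
      then show ?thesis using Md[OF j, of i] bal[of i] stock[OF True] by linarith
    qed (simp add: M0[OF j])
    define s' where "s' = (\<lambda>i. s i - M j i + I i)"
    define v' where "v' = (\<lambda>i. u i - I\<^sub>0 i + M j i)"
    define loss' where "loss' = (\<lambda>i. loss i + M j i)"
    define gain' where "gain' = (\<lambda>i. gain i + (if i = z then 1 else 0))"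
    have "(\<lambda>i. s' i + v' i) = (\<lambda>i. s i + (u i - I\<^sub>0 i) + I i)"
      unfolding s'_def v'_def using Ms by (simp add: fun_eq_iff trans_le_add1)
    then have 1: "y (\<lambda>i. s' i + v' i) \<noteq> \<infinity>" using y by simp
    have 2: "s' \<in> exponents n" using s In by (auto simp: s'_def exponents_def)
    have 3: "v' \<in> newton L" unfolding v'_def by (intro move M_face j)
    have "exp_deg n (\<lambda>i. s i - M j i) \<le> exp_deg n s" unfolding exp_deg_def by (intro sum_mono) auto
    then have 4: "exp_deg n s' \<le> exp_deg n t + Suc q * d"
      using deg_s degf[OF j I(1)] unfolding s'_def exp_deg_add by simp
    have 5: "t i + gain' i \<le> s' i + loss' i" for i
      using bal[of i] Ms[of i] z(2) unfolding s'_def gain'_def loss'_def by auto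
    have 6: "loss' i = 0" if "i \<notin> L'" for i using that loss(1) M0[OF j] by (simp add: loss'_def)
    have 7: "exp_deg n loss' \<le> (k + Suc q) * d"
      using loss(2) degM[OF j] unfolding loss'_def exp_deg_add by (simp add: algebra_simps)
    have 8: "gain' i = 0" if "i \<in> L" for i using that gain(1) z(1) by (auto simp: gain'_def)
    have "exp_deg n (\<lambda>i. if i = z then 1 else 0) = 1" unfolding exp_deg_def using zn by simp
    then have 9: "exp_deg n gain' = Suc q" using gain(2) unfolding gain'_def exp_deg_add by simp
    show ?case using 1 2 3 4 5 6 7 8 9 by blast
  qed
  obtain s v loss gain where s: "s \<in> exponents n" and v: "v \<in> newton L" "y (\<lambda>i. s i + v i) \<noteq> \<infinity>"
      and deg_s: "exp_deg n s \<le> exp_deg n t + k * d"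
      and bal: "\<And>i. t i + gain i \<le> s i + loss i"
      and loss: "\<And>i. i \<notin> L' \<Longrightarrow> loss i = 0" "exp_deg n loss \<le> (k + k) * d"
      and gain: "\<And>i. i \<in> L \<Longrightarrow> gain i = 0" "exp_deg n gain = k"
    using run[of k] by auto
  have v0: "v i = 0" if "i \<notin> L" for i using v(1) that by (auto simp: R.newton_points_def)
  have "exp_deg n v \<le> k * d"
  proof -
    obtain j I where j: "j \<in> active L" "I \<in> face L j"
      "(\<Sum>i\<in>L. v i) + deg j \<le> (\<Sum>i\<in>L. I i) + (\<Sum>j\<in>active L. deg j)"
      using R.newton_point_step[OF v(1)] by blast
    have "exp_deg n v = (\<Sum>i\<in>L. v i)"
      unfolding exp_deg_def using Ln v0 by (intro sum.mono_neutral_right) auto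
    then show ?thesis using j(3) R.S_degree[OF j(1,2)] deg_sum by simp
  qed
  then have "exp_deg n (\<lambda>i. s i + v i) \<le> exp_deg n t + 2 * k * d"
    using deg_s unfolding exp_deg_add by simp
  moreover have "v i = 0" if "i \<ge> n" for i using v0[of i] subsetD[OF Ln, of i] that by fastforce
  then have "(\<lambda>i. s i + v i) \<in> exponents n" using s by (simp add: exponents_def)
  moreover have "t i + gain i \<le> s i + v i + loss i" for i using bal[of i] by simp
  moreover have "exp_deg n loss \<le> 2 * k * d" using loss(2) by (simp add: algebra_simps)
  ultimately show ?thesis using v(2) loss(1) gain by blast
qed

end

section \<open>The potential that bounds the number of trades\<close>

text \<open>
  A concave, bounded function of an exponent: the levels are intervals of length \<open>H\<close>, each unit in level \<open>q < M\<close> is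
  worth \<open>B ^ (M - q)\<close>, and units from level \<open>M\<close> on are worthless.
\<close>

definition level_value :: "nat \<Rightarrow> nat \<Rightarrow> nat \<Rightarrow> nat \<Rightarrow> nat" where
  "level_value B M H x = (\<Sum>z<x. if z < H * M then B ^ (M - z div H) else 0)"

lemma level_value_mono: "x \<le> x' \<Longrightarrow> level_value B M H x \<le> level_value B M H x'"
  unfolding level_value_def by (intro sum_mono2) auto

lemma level_value_split:
  "level_value B M H (x + g) = level_value B M H x + (\<Sum>z=x..<x + g. if z < H * M then B ^ (M - z div H) else 0)"
  unfolding level_value_def lessThan_atLeast0 by (rule sum.atLeastLessThan_concat[symmetric]) auto

lemma level_value_gain:
  assumes B: "B > 0" and x: "x + g \<le> H * Suc q" and q: "q < M"
  shows "level_value B M H x + g * B ^ (M - q) \<le> level_value B M H (x + g)"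
proof -
  have "(\<Sum>z=x..<x + g. B ^ (M - q)) \<le> (\<Sum>z=x..<x + g. if z < H * M then B ^ (M - z div H) else 0)"
  proof (intro sum_mono)
    fix z assume z: "z \<in> {x..<x + g}"
    then have "z < Suc q * H" using x by (simp add: algebra_simps)
    then have "z div H < Suc q" by (rule less_mult_imp_div_less)
    moreover have "H * Suc q \<le> H * M" using q by (intro mult_le_mono2) simp
    ultimately show "B ^ (M - q) \<le> (if z < H * M then B ^ (M - z div H) else 0)"
      using B z x by (auto intro!: power_increasing)
  qed
  then show ?thesis unfolding level_value_split by simp
qed

lemma level_value_loss:
  assumes B: "B > 0" and H: "H > 0" and x: "H * q \<le> x"
  shows "level_value B M H (x + g) \<le> level_value B M H x + g * B ^ (M - q)"
proof -
  have "(\<Sum>z=x..<x + g. if z < H * M then B ^ (M - z div H) else 0) \<le> (\<Sum>z=x..<x + g. B ^ (M - q))"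
  proof (intro sum_mono)
    fix z assume z: "z \<in> {x..<x + g}"
    then have "q * H \<le> z" using x by (simp add: algebra_simps)
    then have "q \<le> z div H" using H by (simp add: less_eq_div_iff_mult_less_eq)
    then show "(if z < H * M then B ^ (M - z div H) else 0) \<le> B ^ (M - q)"
      using B by (auto intro!: power_increasing)
  qed
  then show ?thesis unfolding level_value_split by simp
qed

lemma level_value_bound:
  assumes B: "B > 0"
  shows "level_value B M H x \<le> H * M * B ^ M"
proof -
  have "level_value B M H x = (\<Sum>z\<in>{..<x} \<inter> {..<H * M}. B ^ (M - z div H))"
    unfolding level_value_def by (simp add: sum.If_cases lessThan_def Collect_conj_eq)
  also have "\<dots> \<le> (\<Sum>z<H * M. B ^ (M - z div H))" by (intro sum_mono2) auto
  also have "\<dots> \<le> (\<Sum>z<H * M. B ^ M)" using B by (intro sum_mono power_increasing) auto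
  finally show ?thesis by simp
qed

text \<open>
  Otherwise each of the first \<open>min (card A) (card C) + 1\<close> steps of the chain loses an element both of \<open>L q\<close> and
  of \<open>W (L q)\<close>.
\<close>

lemma chain_stabilises:
  fixes L :: "nat \<Rightarrow> 'a set" and W :: "'a set \<Rightarrow> 'b set"
  assumes fin: "finite A" "finite C" and sub: "\<And>q. L q \<subseteq> A" "\<And>X. W X \<subseteq> C"
    and mono: "\<And>X Y. X \<subseteq> Y \<Longrightarrow> W X \<subseteq> W Y" and anti: "\<And>q. L (Suc q) \<subseteq> L q"
  shows "\<exists>q\<in>{1..min (card A) (card C) + 1}. W (L q) \<subseteq> W (L (Suc q))"
proof (rule ccontr)
  let ?m = "min (card A) (card C)"
  assume no: "\<not> ?thesis"
  have "card (W (L (Suc r))) + r \<le> card C \<and> card (L (Suc r)) + r \<le> card A" if "r \<le> Suc ?m" for r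
    using that
  proof (induction r)
    case 0
    then show ?case using fin sub by (simp add: card_mono)
  next
    case (Suc r)
    have "\<not> W (L (Suc r)) \<subseteq> W (L (Suc (Suc r)))" using no Suc.prems by auto
    then have "W (L (Suc (Suc r))) \<subset> W (L (Suc r))" "L (Suc (Suc r)) \<subset> L (Suc r)"
      using mono[OF anti[of "Suc r"]] anti[of "Suc r"] by auto
    then have "card (W (L (Suc (Suc r)))) < card (W (L (Suc r)))" "card (L (Suc (Suc r))) < card (L (Suc r))"
      using fin sub by (meson finite_subset psubset_card_mono)+
    then show ?case using Suc by simp
  qed
  from this[of "Suc ?m"] show False by auto
qed

context solved_macaulay_system
begin

lemma face_mono: "X \<subseteq> Y \<Longrightarrow> face X j \<subseteq> face Y j"
  by (auto simp: face_def)

lemma active_mono: "X \<subseteq> Y \<Longrightarrow> active X \<subseteq> active Y"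
  unfolding active_def using face_mono by blast

text \<open>
  The stock loses at most \<open>2 * k * d\<close> units, each worth at most \<open>(4 * e) ^ (M - q)\<close>, and the variables below
  level \<open>q\<close> gain \<open>k\<close> units, each worth at least \<open>4 * e\<close> times as much. The level length \<open>3 * k * e\<close> leaves room
  for the loss of \<open>2 * k * d\<close> and for the margin \<open>k\<close> in the choice of the chain. The maximum \<open>e\<close> keeps the values positive for
  constant polynomials, where \<open>d = 0\<close>.
\<close>

lemma potential_increases:
  assumes rootless: "\<And>L. L \<subseteq> {..<n} \<Longrightarrow> rootless_on L"
    and k: "k = length F" "k > 0" and d: "\<And>j. j < k \<Longrightarrow> deg j \<le> d"
    and e: "e = max d 1" and H: "H = 3 * k * e" and M: "M = min n k + 2"
    and t: "t \<in> exponents n" "y t \<noteq> \<infinity>" "exp_deg n t + 2 * k * d \<le> N"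
  shows "\<exists>t'\<in>exponents n. y t' \<noteq> \<infinity> \<and> exp_deg n t' \<le> exp_deg n t + 2 * k * d \<and>
     (\<Sum>i<n. level_value (4 * e) M H (t i)) < (\<Sum>i<n. level_value (4 * e) M H (t' i))"
proof -
  \<comment> \<open>The margin \<open>k\<close> keeps a variable outside \<open>L q\<close> below level \<open>q\<close> even after gaining \<open>k\<close> units.\<close>
  define L where "L = (\<lambda>q. {i. i < n \<and> H * q \<le> t i + k})"
  have "\<exists>q\<in>{1..min (card {..<n}) (card {..<k}) + 1}. active (L q) \<subseteq> active (L (Suc q))"
  proof (rule chain_stabilises[of "{..<n}" "{..<k}" L active])
    show "L (Suc q) \<subseteq> L q" for q unfolding L_def using mult_le_mono2[of q "Suc q" H] by force
  qed (use active_mono k in \<open>auto simp: L_def active_def\<close>)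
  then obtain q where q: "1 \<le> q" "q < M" and stable: "active (L q) \<subseteq> active (L (Suc q))"
    using M by auto
  define P where "P = k * e"
  have P: "k \<le> P" "k * d \<le> P" "P > 0" "H = 3 * P" using k(2) by (auto simp: P_def e H)
  have "L q \<subseteq> {..<n}" by (auto simp: L_def)
  moreover have stock: "2 * k * d \<le> t i" if "i \<in> L (Suc q)" for i
    using that P q(1) mult_le_mono2[OF q(1), of H] by (auto simp: L_def)
  moreover have "L (Suc q) \<subseteq> L q" unfolding L_def using mult_le_mono2[of q "Suc q" H] by force
  ultimately obtain t' loss gain where t': "t' \<in> exponents n" "y t' \<noteq> \<infinity>" "exp_deg n t' \<le> exp_deg n t + 2 * k * d"
    and bal: "\<And>i. t i + gain i \<le> t' i + loss i"
    and loss: "\<And>i. i \<notin> L (Suc q) \<Longrightarrow> loss i = 0" "exp_deg n loss \<le> 2 * k * d"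
    and gain: "\<And>i. i \<in> L q \<Longrightarrow> gain i = 0" "exp_deg n gain = k"
    using trade_for_new_variables[OF rootless k(1) d t _ _ stable] by blast
  let ?lv = "level_value (4 * e) M H" and ?G = "(4 * e) ^ (M - (q - 1))" and ?X = "(4 * e) ^ (M - q)"
  have B: "4 * e > 0" by (simp add: e)
  have le_deg: "f i \<le> exp_deg n f" if "i < n" for f i
    unfolding exp_deg_def using that by (intro member_le_sum) auto
  have coord: "?lv (t i) + gain i * ?G \<le> ?lv (t' i) + loss i * ?X" if i: "i < n" for i
  proof (cases "i \<in> L (Suc q)")
    case True
    have li: "loss i \<le> 2 * P" using le_deg[OF i, of loss] loss(2) P(2) by simp
    have "H * q + H \<le> t i + k" using True by (simp add: L_def)
    then have x: "H * q \<le> t i - loss i" and "loss i \<le> t i" using li P by auto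
    then have "?lv (t i) \<le> ?lv (t i - loss i) + loss i * ?X"
      using level_value_loss[OF B _ x, of M "loss i"] P by simp
    moreover have "?lv (t i - loss i) \<le> ?lv (t' i)" using bal[of i] by (intro level_value_mono) simp
    moreover have "gain i = 0" using gain(1) True \<open>L (Suc q) \<subseteq> L q\<close> by blast
    ultimately show ?thesis by simp
  next
    case False
    have tt: "t i + gain i \<le> t' i" using bal[of i] loss(1)[OF False] by simp
    show ?thesis
    proof (cases "gain i = 0")
      case True
      then show ?thesis using level_value_mono[OF tt, of "4 * e" M H] by simp
    next
      case gi: False
      then have "t i + k < H * q" using gain(1)[of i] i by (force simp: L_def)
      then have x: "t i + gain i \<le> H * Suc (q - 1)" using le_deg[OF i, of gain] gain(2) q(1) by simp
      have "q - 1 < M" using q by simp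
      from level_value_gain[OF B x this] level_value_mono[OF tt, of "4 * e" M H]
      show ?thesis by linarith
    qed
  qed
  have "(\<Sum>i<n. ?lv (t i)) + k * ?G = (\<Sum>i<n. ?lv (t i) + gain i * ?G)"
    using gain(2) by (simp add: sum.distrib exp_deg_def sum_distrib_right[symmetric])
  also have "\<dots> \<le> (\<Sum>i<n. ?lv (t' i) + loss i * ?X)" using coord by (intro sum_mono) auto
  also have "\<dots> = (\<Sum>i<n. ?lv (t' i)) + exp_deg n loss * ?X"
    by (simp add: sum.distrib exp_deg_def sum_distrib_right[symmetric])
  also have "\<dots> \<le> (\<Sum>i<n. ?lv (t' i)) + 2 * P * ?X"
    using loss(2) P(2) by (intro add_left_mono mult_le_mono1) simp
  finally have fin: "(\<Sum>i<n. ?lv (t i)) + k * ?G \<le> (\<Sum>i<n. ?lv (t' i)) + 2 * P * ?X" .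
  have "M - (q - 1) = Suc (M - q)" using q by simp
  then have "k * ?G = 2 * P * ?X + 2 * P * ?X" by (simp add: P_def)
  moreover have "P * ?X > 0" using P(3) B by simp
  ultimately have "(\<Sum>i<n. ?lv (t i)) < (\<Sum>i<n. ?lv (t' i))" using fin by linarith
  then show ?thesis using t' by blast
qed

text \<open>
  Starting at the exponent vector \<open>0\<close>, every trade raises the integral potential and the degree by at most
  \<open>2 * k * d\<close>, so the potential would exceed its bound before the columns run out.
\<close>

lemma not_rootless:
  assumes rootless: "\<And>L. L \<subseteq> {..<n} \<Longrightarrow> rootless_on L"
    and k: "k = length F" "k > 0" and d: "\<And>j. j < k \<Longrightarrow> deg j \<le> d"
    and e: "e = max d 1" and H: "H = 3 * k * e" and M: "M = min n k + 2"
    and y0: "y (\<lambda>_. 0) \<noteq> \<infinity>" and N: "2 * k * d * (n * (H * M * (4 * e) ^ M) + 1) \<le> N"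
  shows False
proof -
  let ?lv = "\<lambda>x. level_value (4 * e) M H x" and ?R = "n * (H * M * (4 * e) ^ M)"
  have ex: "\<exists>t\<in>exponents n. y t \<noteq> \<infinity> \<and> exp_deg n t \<le> 2 * k * d * r \<and> r \<le> (\<Sum>i<n. ?lv (t i))"
    if "r \<le> ?R + 1" for r
    using that
  proof (induction r)
    case 0
    show ?case using y0 by (intro bexI[of _ "\<lambda>_. 0"]) (auto simp: exponents_def exp_deg_def)
  next
    case (Suc r)
    then obtain t where t: "t \<in> exponents n" "y t \<noteq> \<infinity>" "exp_deg n t \<le> 2 * k * d * r" "r \<le> (\<Sum>i<n. ?lv (t i))"
      by auto
    have "2 * k * d * Suc r \<le> 2 * k * d * (?R + 1)" using Suc.prems by (intro mult_le_mono2)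
    moreover have "exp_deg n t + 2 * k * d \<le> 2 * k * d * Suc r" using t(3) by simp
    ultimately have "exp_deg n t + 2 * k * d \<le> N" using N by (meson le_trans)
    from potential_increases[OF rootless k d e H M t(1,2) this] t(3,4)
    show ?case by fastforce
  qed
  obtain t where t: "?R + 1 \<le> (\<Sum>i<n. ?lv (t i))" using ex[of "?R + 1"] by auto
  have "(\<Sum>i<n. ?lv (t i)) \<le> (\<Sum>i<n. H * M * (4 * e) ^ M)"
    by (intro sum_mono level_value_bound) (simp add: e)
  then show False using t by simp
qed

end

section \<open>Both directions of the equivalence\<close>

lemma exp_eval_add: "exp_eval n (\<lambda>i. J i + I i) x = exp_eval n J x + exp_eval n I x"
  unfolding exp_eval_def sum.distrib[symmetric]
  by (intro sum.cong refl) (simp add: ereal_left_distrib plus_ereal.simps(1)[symmetric] del: plus_ereal.simps(1))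

lemma root_gives_solution:
  assumes x: "\<And>f. f \<in> set F \<Longrightarrow> is_root n f x" and f: "\<And>f. f \<in> set F \<Longrightarrow> is_trop_poly K n f"
    and K: "\<And>I. exp_eval n I x \<in> K"
  shows "macaulay_solution K n F N (\<lambda>I. exp_eval n I x)"
  unfolding macaulay_solution_def is_lin_solution_def
proof (intro conjI ballI)
  fix r assume r: "r \<in> macaulay_rows n F N"
  obtain j J where rj: "r = (j, J)" by force
  have j: "j < length F" and J: "J \<in> exponents n" using r by (auto simp: rj macaulay_rows_def)
  let ?f = "F ! j" and ?e = "\<lambda>I. exp_eval n I x"
  have dom: "finite (dom ?f)" "dom ?f \<subseteq> exponents n" using f[of ?f] j by (auto simp: is_trop_poly_def)
  have van: "\<forall>I\<in>dom ?f. trop_coeff ?f I + ?e I \<noteq> \<infinity> \<longrightarrow>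
     (\<exists>I'\<in>dom ?f. I' \<noteq> I \<and> trop_coeff ?f I' + ?e I' \<le> trop_coeff ?f I + ?e I)"
    using x[of ?f] j unfolding is_root_def trop_vanishes_iff[OF dom(1)] by auto
  have val: "macaulay F r (\<lambda>i. J i + I i) + ?e (\<lambda>i. J i + I i) = ?e J + (trop_coeff ?f I + ?e I)" for I
    unfolding rj macaulay_shift exp_eval_add by (simp add: ac_simps)
  show "trop_vanishes (macaulay_cols n N) (\<lambda>c. macaulay F r c + ?e c)"
    unfolding trop_vanishes_iff[OF finite_macaulay_cols]
  proof (intro ballI impI)
    fix c assume c: "c \<in> macaulay_cols n N" "macaulay F r c + ?e c \<noteq> \<infinity>"
    then have "macaulay F (j, J) c \<noteq> \<infinity>" by (auto simp: rj)
    then obtain I where I: "I \<in> finite_support ?f" "c = (\<lambda>i. J i + I i)"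
      using macaulay_finite_entry by blast
    have "trop_coeff ?f I + ?e I \<noteq> \<infinity>" using c(2) unfolding I(2) val by auto
    then obtain I' where I': "I' \<in> dom ?f" "I' \<noteq> I" and le: "trop_coeff ?f I' + ?e I' \<le> trop_coeff ?f I + ?e I"
      using van I(1) by (auto simp: finite_support_def)
    have fin: "trop_coeff ?f I' \<noteq> \<infinity>" using le \<open>trop_coeff ?f I + ?e I \<noteq> \<infinity>\<close> by auto
    let ?c = "\<lambda>i. J i + I' i"
    have "?c \<in> exponents n" using J I'(1) dom(2) by (auto simp: exponents_def)
    then have "?c \<in> macaulay_cols n N"
      using r fin macaulay_shift[of F j J I'] by (auto simp: macaulay_rows_def rj)
    moreover have "?c \<noteq> c" using I'(2) by (auto simp: I(2) fun_eq_iff)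
    moreover have "macaulay F r ?c + ?e ?c \<le> macaulay F r c + ?e c"
      unfolding I(2) val using le by (rule add_left_mono)
    ultimately show "\<exists>l\<in>macaulay_cols n N. l \<noteq> c \<and> macaulay F r l + ?e l \<le> macaulay F r c + ?e c"
      by blast
  qed
qed (use K in auto)

lemma exp_eval_trop_R:
  assumes "\<forall>i<n. x i \<in> trop_R"
  shows "exp_eval n I x \<in> trop_R"
proof -
  have a: "x i = ereal (real_of_ereal (x i))" if "i < n" for i
    using assms that by (cases "x i") (auto simp: trop_R_def)
  have "ereal (real (I i)) * x i = ereal (real (I i) * real_of_ereal (x i))" if "i < n" for i
    by (subst a[OF that]) simp
  then have "exp_eval n I x = ereal (\<Sum>i<n. real (I i) * real_of_ereal (x i))"
    unfolding exp_eval_def sum_ereal[symmetric] by (intro sum.cong) auto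
  then show ?thesis by (simp add: trop_R_def)
qed

lemma exp_eval_trop_Rinf:
  assumes "\<forall>i<n. x i \<in> trop_Rinf"
  shows "exp_eval n I x \<in> trop_Rinf"
proof -
  have no_minfty: "ereal (real (I i)) * x i \<noteq> -\<infinity>" if "i < n" for i
    using assms that by (cases "x i") (auto simp: trop_Rinf_def)
  have "sum (\<lambda>i. ereal (real (I i)) * x i) A \<noteq> -\<infinity>" if "finite A" "A \<subseteq> {..<n}" for A
    using that
  proof (induction A rule: finite_induct)
    case (insert i A)
    then show ?case
      using no_minfty[of i] unfolding sum.insert[OF insert(1,2)] ereal_plus_eq_MInfty by blast
  qed simp
  then show ?thesis by (simp add: exp_eval_def trop_Rinf_def)
qed

text \<open>
  With all variables in the face there is nothing to escape to, so one application of \<open>leave_face\<close> is absurd.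
\<close>

lemma dual_nullstellensatz_R:
  assumes f: "\<And>f. f \<in> set F \<Longrightarrow> is_trop_poly trop_R n f"
    and N: "(\<Sum>f\<leftarrow>F. trop_deg n f) \<le> N" and y: "macaulay_solution trop_R n F N y"
  shows "has_root trop_R n F"
proof (rule ccontr)
  assume no: "\<not> has_root trop_R n F"
  have sub: "trop_R \<subseteq> trop_Rinf" by (auto simp: trop_R_def trop_Rinf_def)
  interpret solved_macaulay_system n F N y
  proof
    show "is_trop_poly trop_Rinf n g" if "g \<in> set F" for g
      using f[OF that] sub by (auto simp: is_trop_poly_def)
    show "macaulay_solution trop_Rinf n F N y"
      using y sub by (auto simp: macaulay_solution_def is_lin_solution_def)
  qed
  let ?L = "{..<n}"
  have "\<exists>f\<in>set F. \<not> is_root n f (extend_infty ?L a)" for a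
  proof -
    have "\<forall>i<n. extend_infty ?L a i \<in> trop_R" by (simp add: extend_infty_def trop_R_def)
    then show ?thesis using no unfolding has_root_def by blast
  qed
  then have L: "rootless_on ?L" by (simp add: rootless_on_def)
  interpret R: rootless_system ?L "active ?L" "face ?L" real_coeff deg using rootless_system[OF L] .
  have "\<forall>j\<in>active ?L. \<exists>I. I \<in> face ?L j" by (auto simp: active_def)
  then obtain m where m: "\<And>j. j \<in> active ?L \<Longrightarrow> m j \<in> face ?L j" by metis
  let ?v = "\<lambda>i. \<Sum>j\<in>active ?L. m j i"
  have v: "?v \<in> newton ?L" using m by (rule R.sum_of_monomials_newton_point)
  have "(\<Sum>j\<in>active ?L. deg j) \<le> (\<Sum>j<length F. deg j)" by (intro sum_mono2) (auto simp: active_def)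
  also have "\<dots> = (\<Sum>f\<leftarrow>F. trop_deg n f)" by (simp add: sum_list_sum_nth deg_def atLeast0LessThan)
  finally have degs: "(\<Sum>j\<in>active ?L. deg j) \<le> N" using N by simp
  have "exp_deg n ?v = (\<Sum>j\<in>active ?L. exp_deg n (m j))" unfolding exp_deg_def by (rule sum.swap)
  also have "\<dots> \<le> (\<Sum>j\<in>active ?L. deg j)"
    using m R.S_degree unfolding exp_deg_def by (intro sum_mono) blast
  finally have "?v \<in> macaulay_cols n N"
    using degs R.S_support[OF _ m] by (simp add: macaulay_cols_def exponents_def)
  then have "y ?v \<noteq> \<infinity>" using y by (auto simp: macaulay_solution_def is_lin_solution_def trop_R_def)
  moreover have "(\<lambda>_. 0) \<in> exponents n" "exp_deg n (\<lambda>_. 0) = 0" by (auto simp: exponents_def exp_deg_def)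
  ultimately obtain j I where "j \<in> active ?L" "I \<in> finite_support (F ! j) - face ?L j"
    using leave_face[OF L _ _ v, of "\<lambda>_. 0"] degs by auto
  then show False using support_exponents[of j I] by (auto simp: active_def face_def exponents_def)
qed

lemma dual_nullstellensatz_Rinf:
  assumes F: "F \<noteq> []" and f: "\<And>f. f \<in> set F \<Longrightarrow> is_trop_poly trop_Rinf n f"
    and k: "k = length F" and d: "\<And>f. f \<in> set F \<Longrightarrow> trop_deg n f \<le> d"
    and N: "2 * k * d * (n * (3 * k * max d 1 * (min n k + 2) * (4 * max d 1) ^ (min n k + 2)) + 1) \<le> N"
    and y: "macaulay_solution trop_Rinf n F N y" "y (\<lambda>_. 0) \<noteq> \<infinity>"
  shows "has_root trop_Rinf n F"
proof (rule ccontr)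
  assume no: "\<not> has_root trop_Rinf n F"
  interpret solved_macaulay_system n F N y by standard (use f y in auto)
  have "rootless_on L" if "L \<subseteq> {..<n}" for L
  proof -
    have "\<forall>i<n. extend_infty L a i \<in> trop_Rinf" for a by (simp add: extend_infty_def trop_Rinf_def)
    then show ?thesis using no that unfolding has_root_def rootless_on_def by blast
  qed
  then show False
    using not_rootless[OF _ k _ _ refl refl refl y(2) N] F k d by (auto simp: deg_def)
qed

text \<open>
  The variables \<open>n\<close>, \<open>k\<close>, \<open>d\<close> belong to the innermost, the middle and the outermost polynomial layer. The value
  collects the factors of the bound in \<open>not_rootless\<close> apart from \<open>(4 * d) ^ min n k\<close>, with \<open>min n k + 2\<close> estimated by
  \<open>n + 2\<close> where it is not an exponent.
\<close>

definition degree_poly :: "nat poly poly poly" where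
  "degree_poly = (let Xd = [:0, 1:]; Xk = [:[:0, 1:]:]; Xn = [:[:[:0, 1:]:]:]; c = (\<lambda>m. [:[:[:m:]:]:])
     in c 2 * Xk * Xd + c 96 * Xn * (Xn + c 2) * Xk ^ 2 * Xd ^ 4)"

lemma poly3_degree_poly:
  "poly3 degree_poly n k d = 2 * k * d + 96 * n * (n + 2) * k ^ 2 * d ^ 4"
  by (simp add: poly3_def degree_poly_def Let_def algebra_simps power2_eq_square power4_eq_xxxx)

lemma degree_poly_bound:
  "2 * k * d * (n * (3 * k * max d 1 * (min n k + 2) * (4 * max d 1) ^ (min n k + 2)) + 1)
    \<le> poly3 degree_poly n k d * (4 * d) ^ min n k"
proof (cases "d = 0")
  case False
  let ?P = "(4 * d) ^ min n k"
  have m: "max d 1 = d" using False by simp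
  have "2 * k * d * (n * (3 * k * d * (min n k + 2) * (4 * d) ^ (min n k + 2)) + 1)
     \<le> 2 * k * d * (n * (3 * k * d * (n + 2) * (4 * d) ^ (min n k + 2)) + ?P)"
    using False by (intro mult_le_mono add_le_mono) auto
  also have "\<dots> = poly3 degree_poly n k d * ?P"
    unfolding poly3_degree_poly by (simp add: algebra_simps power2_eq_square power4_eq_xxxx power_add)
  finally show ?thesis unfolding m .
qed simp

theorem theorem4:
  shows "(\<forall>(n::nat) F.
            (\<forall>f\<in>set F. is_trop_poly trop_R n f) \<longrightarrow>
            (let N = (n + 2) * (\<Sum>f\<leftarrow>F. trop_deg n f) in
               has_root trop_R n F \<longleftrightarrow> (\<exists>y. macaulay_solution trop_R n F N y)))
       \<and> (\<exists>p :: nat poly poly poly. \<forall>(n::nat) F.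
            F \<noteq> [] \<longrightarrow> (\<forall>f\<in>set F. is_trop_poly trop_Rinf n f) \<longrightarrow>
            (let k = length F;
                 d = Max (trop_deg n ` set F);
                 N = poly3 p n k d * (4 * d) ^ min n k in
               has_root trop_Rinf n F \<longleftrightarrow>
                 (\<exists>y. macaulay_solution trop_Rinf n F N y \<and> y (\<lambda>_. 0) = 0)))"
proof (intro conjI exI[of _ degree_poly] allI impI; unfold Let_def)
  fix n :: nat and F :: "trop_poly list"
  assume f: "\<forall>f\<in>set F. is_trop_poly trop_R n f"
  let ?N = "(n + 2) * (\<Sum>f\<leftarrow>F. trop_deg n f)"
  show "has_root trop_R n F \<longleftrightarrow> (\<exists>y. macaulay_solution trop_R n F ?N y)"
  proof
    assume "has_root trop_R n F"
    then obtain x where "\<forall>i<n. x i \<in> trop_R" "\<forall>f\<in>set F. is_root n f x" by (auto simp: has_root_def)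
    then have "macaulay_solution trop_R n F ?N (\<lambda>I. exp_eval n I x)"
      using f by (intro root_gives_solution exp_eval_trop_R) auto
    then show "\<exists>y. macaulay_solution trop_R n F ?N y" by blast
  next
    assume "\<exists>y. macaulay_solution trop_R n F ?N y"
    then show "has_root trop_R n F" using f dual_nullstellensatz_R[of F n ?N] by auto
  qed
next
  fix n :: nat and F :: "trop_poly list"
  assume F: "F \<noteq> []" and f: "\<forall>f\<in>set F. is_trop_poly trop_Rinf n f"
  let ?k = "length F" and ?d = "Max (trop_deg n ` set F)"
  let ?N = "poly3 degree_poly n ?k ?d * (4 * ?d) ^ min n ?k"
  show "has_root trop_Rinf n F \<longleftrightarrow> (\<exists>y. macaulay_solution trop_Rinf n F ?N y \<and> y (\<lambda>_. 0) = 0)"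
  proof
    assume "has_root trop_Rinf n F"
    then obtain x where "\<forall>i<n. x i \<in> trop_Rinf" "\<forall>f\<in>set F. is_root n f x" by (auto simp: has_root_def)
    then have "macaulay_solution trop_Rinf n F ?N (\<lambda>I. exp_eval n I x)"
      using f by (intro root_gives_solution exp_eval_trop_Rinf) auto
    moreover have "exp_eval n (\<lambda>_. 0) x = 0" by (simp add: exp_eval_def zero_ereal_def[symmetric])
    ultimately show "\<exists>y. macaulay_solution trop_Rinf n F ?N y \<and> y (\<lambda>_. 0) = 0" by blast
  next
    assume "\<exists>y. macaulay_solution trop_Rinf n F ?N y \<and> y (\<lambda>_. 0) = 0"
    then obtain y where "macaulay_solution trop_Rinf n F ?N y" "y (\<lambda>_. 0) \<noteq> \<infinity>" by auto
    moreover have "trop_deg n g \<le> ?d" if "g \<in> set F" for g using that by simp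
    ultimately show "has_root trop_Rinf n F"
      using dual_nullstellensatz_Rinf[OF F _ refl _ degree_poly_bound] f by blast
  qed
qed

end
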